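(* Let $\Gamma$ be a mature graph and let $u,v$ be two (distinct) vertices of $\Gamma$. Let $\hat\Gamma=\Gamma\cup e$ be the graph obtained from $\Gamma$ by adding an edge $e$ connecting $u$ and $v$. If the complement $\Gamma-\{u,v\}$ is connected, then $\hat\Gamma$ is mature as well.
   Context: A graph means a finite 1-dimensional simplicial complex (so it has at least one edge). For a space $X$, $F(X,2)=\{(x,y)\in X\times X: x\neq y\}$. Homology is with integer coefficients. A finite connected graph $\Gamma$ which is not homeomorphic to the interval $[0,1]$ is called mature if the homomorphism $\alpha_*:H_1(F(\Gamma,2))\to H_1(\Gamma\times\Gamma)$ induced by the inclusion $\alpha:F(\Gamma,2)\to\Gamma\times\Gamma$ is an isomorphism. Maturity is invariant under subdivision of the graph. The complement $\Gamma-\{u,v\}$ is the topological complement of the two points. *)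

theory Defs
  imports "HOL-Homology.Homology"
begin

definition abstract_simplicial_complex :: "'v set set \<Rightarrow> bool" where
  "abstract_simplicial_complex K \<longleftrightarrow>
     (\<forall>s\<in>K. finite s \<and> s \<noteq> {}) \<and> (\<forall>s\<in>K. \<forall>t. t \<noteq> {} \<and> t \<subseteq> s \<longrightarrow> t \<in> K)"

definition graph :: "'v set set \<Rightarrow> bool" where
  "graph K \<longleftrightarrow> abstract_simplicial_complex K \<and> finite K \<and>
     (\<forall>s\<in>K. card s \<le> 2) \<and> (\<exists>s\<in>K. card s = 2)"

text \<open>Geometric realization in barycentric coordinates.  The product topology on functions
  induces the usual (weak) topology of the realization because the complexes considered here
  are finite.\<close>

definition realization :: "'v set set \<Rightarrow> ('v \<Rightarrow> real) topology" where
  "realization K = top_of_set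
     {f. (\<forall>x. 0 \<le> f x) \<and> {x. f x \<noteq> 0} \<in> K \<and> (\<Sum>x\<in>{x. f x \<noteq> 0}. f x) = 1}"

definition vertex_point :: "'v \<Rightarrow> 'v \<Rightarrow> real" where
  "vertex_point u = indicator {u}"

definition config2 :: "'a topology \<Rightarrow> ('a \<times> 'a) topology" where
  "config2 X = subtopology (prod_topology X X) {(x, y). x \<noteq> y}"

definition mature :: "'v set set \<Rightarrow> bool" where
  "mature K \<longleftrightarrow> graph K \<and> connected_space (realization K) \<and>
     \<not> realization K homeomorphic_space top_of_set {0..1::real} \<and>
     hom_induced 1 (config2 (realization K)) {}
         (prod_topology (realization K) (realization K)) {} id
       \<in> iso (homology_group 1 (config2 (realization K)))
             (homology_group 1 (prod_topology (realization K) (realization K)))"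

text \<open>If \<open>{u, v}\<close> is already an edge of \<open>K\<close>, then \<open>add_edge u v K = K\<close>; no parallel edge is
  created.  This does not matter when \<open>K\<close> is connected, not homeomorphic to the interval, and
  stays connected after removal of the points \<open>u\<close> and \<open>v\<close>: the interior of an edge \<open>{u, v}\<close>
  would be clopen in the complement of \<open>u\<close> and \<open>v\<close>, hence all of it, and the realization would
  be a closed interval.\<close>

definition add_edge :: "'v \<Rightarrow> 'v \<Rightarrow> 'v set set \<Rightarrow> 'v set set" where
  "add_edge u v K = insert {u, v} K"

end

theory Submission
  imports Defs "HOL-Library.Transitive_Closure_Table"
begin

text \<open>Let \<open>\<Gamma>\<close> be the mature graph, \<open>X = \<Gamma> \<union> e\<close> the new one and \<open>u\<close>, \<open>v\<close> the ends of \<open>e\<close>.  If \<open>{u, v}\<close> is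
  already an edge, nothing changes.  Otherwise the edge is made available to the two particles one
  at a time: the inclusion of pairs of distinct points is compared with the full product first for
  \<open>\<Gamma> \<times> \<Gamma>\<close>, then for \<open>\<Gamma> \<times> X\<close>, and, after exchanging the factors, for \<open>X \<times> \<Gamma>\<close> and finally \<open>X \<times> X\<close>.  Each
  enlargement of the second factor is an instance of \<open>second_factor_step\<close>, with the first particle
  moving in \<open>Z = \<Gamma>\<close> or \<open>Z = X\<close>.

  Injectivity.  A 1-dimensional class of distinct pairs that vanishes in \<open>Z \<times> X\<close> also vanishes when
  projected to the second particle, so that this particle crosses \<open>e\<close> with total multiplicity zero.
  Cover the distinct pairs by a neighbourhood of those with second point in \<open>\<Gamma>\<close>, and by those with
  second point inside \<open>e\<close>.  The overlap has two path components, one near each end of \<open>e\<close>; up to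
  homotopy they are \<open>Z - {u}\<close> and \<open>Z - {v}\<close>, while the part over the open edge looks like \<open>\<Gamma>\<close>.  The
  class comes from the first member of the cover as soon as \<open>H\<^sub>1(\<Gamma> - {u}) \<oplus> H\<^sub>1(\<Gamma> - {v}) \<rightarrow> H\<^sub>1(\<Gamma>)\<close> is
  onto, and this is the Mayer--Vietoris sequence for a connected intersection \<open>\<Gamma> - {u, v}\<close>
  (\<open>H1_sum_of_open_cover\<close>, \<open>H1_collars_surj\<close>, \<open>configuration_class_from_Old\<close>).  So it comes from a class
  of pairs with second point in \<open>\<Gamma>\<close>; that class vanishes in \<open>Z \<times> \<Gamma>\<close>, because \<open>\<Gamma>\<close> is a retract of \<open>X\<close>,
  and hence is zero by the hypothesis on \<open>Z \<times> \<Gamma>\<close>.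

  Surjectivity.  As \<open>\<Gamma>\<close> is not an interval, an arc from \<open>u\<close> to \<open>v\<close> in \<open>\<Gamma>\<close> misses some point \<open>w\<close>
  (\<open>arc_missing_point\<close>).  Given a class of \<open>Z \<times> X\<close>, the part of its second projection that crosses \<open>e\<close>
  can be closed up along this arc and realized with the first particle resting at \<open>w\<close>
  (\<open>H1_X_sum\<close>).  The remainder crosses \<open>e\<close> with multiplicity zero and therefore comes from \<open>Z \<times> \<Gamma>\<close>
  (\<open>product_class_from_Near\<close>), where the hypothesis applies.

  Finally \<open>X\<close> is not an interval, since a connected closed subset of an interval with at least two
  points, such as \<open>\<Gamma>\<close>, would be an interval itself.\<close>

section \<open>Singular homology of subspaces\<close>

abbreviation H :: "int \<Rightarrow> 'a::topological_space set \<Rightarrow> 'a chain set monoid" where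
  "H p S \<equiv> homology_group p (top_of_set S)"

abbreviation Hmap :: "int \<Rightarrow> 'a::topological_space set \<Rightarrow> 'b::topological_space set \<Rightarrow>
    ('a \<Rightarrow> 'b) \<Rightarrow> 'a chain set \<Rightarrow> 'b chain set" where
  "Hmap p S T f \<equiv> hom_induced p (top_of_set S) {} (top_of_set T) {} f"

text \<open>A path between the two points is a singular 1-simplex bounding their difference; it lives in a path
  component, to which the corresponding fact for path-connected spaces applies.\<close>
lemma singular_simplex_0_homologous:
  assumes "singular_simplex 0 Y s" "singular_simplex 0 Y s'"
    and "path_component_of Y (s (\<lambda>j. if j = 0 then 1 else 0)) (s' (\<lambda>j. if j = 0 then 1 else 0))"
  shows "homologous_rel 0 Y {} (frag_of s) (frag_of s')"
proof -
  let ?p = "\<lambda>j::nat. if j = 0 then 1 else (0::real)"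
  define P where "P = Collect (path_component_of Y (s ?p))"
  have pc: "path_connectedin Y P"
    unfolding P_def by (rule path_connectedin_path_component_of)
  have "s ` standard_simplex 0 \<subseteq> P" "s' ` standard_simplex 0 \<subseteq> P"
    using assms by (auto simp: standard_simplex_0 P_def path_component_of_refl
        path_component_in_topspace dest: path_component_in_topspace)
  then have "singular_simplex 0 (subtopology Y P) s" "singular_simplex 0 (subtopology Y P) s'"
    using assms by (auto simp: singular_simplex_subtopology)
  then have "homologous_rel 0 (subtopology Y P) {} (frag_of s) (frag_of s')"
    using pc by (intro iso_integer_zeroth_homology_group_aux) (auto simp: path_connectedin_def)
  then show ?thesis
    unfolding homologous_rel_def
    using singular_boundary_mono[of P UNIV 0 Y] by simp
qed

text \<open>No choice of paths depending continuously on the point is required, because 0-chains only see finitely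
  many points at a time.  Consequences are the two injectivity criteria for \<open>H\<^sub>0\<close> below.\<close>
lemma H0_map_eq_if_path_connected_pointwise:
  assumes f: "continuous_map X Y f" and g: "continuous_map X Y g"
    and pc: "\<And>x. x \<in> topspace X \<Longrightarrow> path_component_of Y (f x) (g x)"
  shows "hom_induced 0 X {} Y {} f = hom_induced 0 X {} Y {} g"
proof
  fix c
  show "hom_induced 0 X {} Y {} f c = hom_induced 0 X {} Y {} g c"
  proof (cases "c \<in> carrier (homology_group 0 X)")
    case False
    then show ?thesis by (simp add: hom_induced_default)
  next
    case True
    then obtain a where a: "singular_relcycle 0 X {} a" "c = homologous_rel_set 0 X {} a"
      by (auto simp: carrier_relative_homology_group_0)
    have "homologous_rel 0 Y {} (chain_map 0 f d) (chain_map 0 g d)" if "singular_chain 0 X d" for d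
      using that unfolding singular_chain_def
    proof (induction d rule: frag_induction)
      case zero
      then show ?case by simp
    next
      case (one s)
      let ?p = "\<lambda>j::nat. if j = 0 then 1 else (0::real)"
      have s: "singular_simplex 0 X s" using one by simp
      then have "s ?p \<in> topspace X"
        by (auto simp: singular_simplex_def continuous_map_def)
      then have "path_component_of Y (simplex_map 0 f s ?p) (simplex_map 0 g s ?p)"
        using pc by (simp add: simplex_map_def)
      then have "homologous_rel 0 Y {} (frag_of (simplex_map 0 f s)) (frag_of (simplex_map 0 g s))"
        by (intro singular_simplex_0_homologous singular_simplex_simplex_map[OF s] f g)
      then show ?case by (simp add: chain_map_of)
    next
      case (diff a b)
      then show ?case by (simp add: chain_map_diff homologous_rel_diff)
    qed
    then have "homologous_rel_set 0 Y {} (chain_map 0 f a) = homologous_rel_set 0 Y {} (chain_map 0 g a)"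
      using a by (simp add: singular_relcycle homologous_rel_set_eq)
    then show ?thesis
      using hom_induced_chain_map[OF f _ a(1), of "{}"] hom_induced_chain_map[OF g _ a(1), of "{}"]
      by (simp add: a(2))
  qed
qed

lemma Hmap_comp:
  assumes "continuous_on S f" "f \<in> S \<rightarrow> T" "continuous_on T g" "g \<in> T \<rightarrow> U"
  shows "Hmap p T U g (Hmap p S T f c) = Hmap p S U (g \<circ> f) c"
  using assms by (intro hom_induced_compose') (auto simp: continuous_map_in_subtopology)

lemma Hmap_cong:
  assumes "\<And>x. x \<in> S \<Longrightarrow> f x = g x"
  shows "Hmap p S T f = Hmap p S T g"
  using assms by (intro hom_induced_eq) auto

lemma Hmap_carrier: "Hmap p S T f c \<in> carrier (H p T)"
  by (rule hom_induced_carrier)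

lemma Hmap_ident:
  assumes "\<And>x. x \<in> S \<Longrightarrow> f x = x" "c \<in> carrier (H p S)"
  shows "Hmap p S S f c = c"
  using Hmap_cong[of S f id p S] assms by (simp add: hom_induced_id)

lemma Hmap_mult:
  assumes "a \<in> carrier (H p S)" "b \<in> carrier (H p S)"
  shows "Hmap p S T f (a \<otimes>\<^bsub>H p S\<^esub> b) = Hmap p S T f a \<otimes>\<^bsub>H p T\<^esub> Hmap p S T f b"
  using hom_mult[OF hom_induced_hom assms] .

lemma Hmap_inv:
  assumes "a \<in> carrier (H p S)"
  shows "Hmap p S T f (inv\<^bsub>H p S\<^esub> a) = inv\<^bsub>H p T\<^esub> (Hmap p S T f a)"
  using group_hom.hom_inv[of "H p S" "H p T" "Hmap p S T f" a] assms
  by (simp add: group_hom_def group_hom_axioms_def hom_induced_hom)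

lemma hom_induced_one:
  "hom_induced p X S Y T f \<one>\<^bsub>relative_homology_group p X S\<^esub> = \<one>\<^bsub>relative_homology_group p Y T\<^esub>"
  by (rule hom_one[OF hom_induced_hom]) auto

lemma hom_boundary_one:
  "hom_boundary p X S \<one>\<^bsub>relative_homology_group p X S\<^esub> = \<one>\<^bsub>homology_group (p - 1) (subtopology X S)\<^esub>"
  by (rule hom_one[OF hom_boundary_hom]) auto

text \<open>A homotopy is given as one map on \<open>{0..1} \<times> S\<close>, in the form in which continuity is proved later.\<close>
lemma Hmap_homotopic:
  assumes "continuous_on ({0..1} \<times> S) h" "h \<in> {0..1::real} \<times> S \<rightarrow> T"
  shows "Hmap p S T (\<lambda>x. h (0, x)) = Hmap p S T (\<lambda>x. h (1, x))"
proof (rule homology_homotopy_empty)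
  show "homotopic_with (\<lambda>h. True) (top_of_set S) (top_of_set T) (\<lambda>x. h (0, x)) (\<lambda>x. h (1, x))"
    unfolding homotopic_with_def
  proof (intro exI[of _ h] conjI)
    have "prod_topology (top_of_set {0..1::real}) (top_of_set S) = top_of_set ({0..1} \<times> S)"
      by simp
    then show "continuous_map (prod_topology (top_of_set {0..1}) (top_of_set S)) (top_of_set T) h"
      using assms by (auto simp: continuous_map_in_subtopology)
  qed auto
qed

text \<open>This and the next three lemmas are the exact sequence of a pair, one inclusion at a time, written for
  subsets so that no iterated subtopologies remain.\<close>
lemma exact_absolute:
  assumes "A \<subseteq> X" "x \<in> carrier (H p X)"
    and "hom_induced p (top_of_set X) {} (top_of_set X) A id x = \<one>\<^bsub>relative_homology_group p (top_of_set X) A\<^esub>"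
  shows "\<exists>a \<in> carrier (H p A). x = Hmap p A X id a"
proof -
  have [simp]: "subtopology (top_of_set X) A = top_of_set A"
    using assms by (simp add: subtopology_subtopology Int_absorb1)
  show ?thesis
    using homology_exactness_axiom_3[of p "top_of_set X" A] assms
    by (auto simp: kernel_def set_eq_iff image_iff)
qed

lemma exact_absolute_trivial:
  assumes "A \<subseteq> X" "a \<in> carrier (H p A)"
  shows "hom_induced p (top_of_set X) {} (top_of_set X) A id (Hmap p A X id a)
       = \<one>\<^bsub>relative_homology_group p (top_of_set X) A\<^esub>"
proof -
  have [simp]: "subtopology (top_of_set X) A = top_of_set A"
    using assms by (simp add: subtopology_subtopology Int_absorb1)
  show ?thesis
    using homology_exactness_axiom_3[of p "top_of_set X" A] assms
    by (auto simp: kernel_def set_eq_iff image_iff)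
qed

lemma exact_relative:
  assumes "A \<subseteq> X" "w \<in> carrier (relative_homology_group p (top_of_set X) A)"
    and "hom_boundary p (top_of_set X) A w = \<one>\<^bsub>H (p - 1) A\<^esub>"
  shows "\<exists>x \<in> carrier (H p X). w = hom_induced p (top_of_set X) {} (top_of_set X) A id x"
proof -
  have [simp]: "subtopology (top_of_set X) A = top_of_set A"
    using assms by (simp add: subtopology_subtopology Int_absorb1)
  show ?thesis
    using homology_exactness_axiom_1[of p "top_of_set X" A] assms
    by (auto simp: kernel_def set_eq_iff image_iff)
qed

lemma exact_boundary_trivial:
  assumes "A \<subseteq> X" "w \<in> carrier (relative_homology_group p (top_of_set X) A)"
  shows "Hmap (p - 1) A X id (hom_boundary p (top_of_set X) A w) = \<one>\<^bsub>H (p - 1) X\<^esub>"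
proof -
  have [simp]: "subtopology (top_of_set X) A = top_of_set A"
    using assms by (simp add: subtopology_subtopology Int_absorb1)
  show ?thesis
    using homology_exactness_axiom_2[of p "top_of_set X" A] assms
    by (auto simp: kernel_def set_eq_iff image_iff)
qed

lemma boundary_natural:
  assumes "A \<subseteq> X" "C \<subseteq> Y" "continuous_on X f" "f \<in> X \<rightarrow> Y" "f \<in> A \<rightarrow> C"
  shows "hom_boundary p (top_of_set Y) C (hom_induced p (top_of_set X) A (top_of_set Y) C f w)
       = Hmap (p - 1) A C f (hom_boundary p (top_of_set X) A w)"
proof -
  have "subtopology (top_of_set X) A = top_of_set A" "subtopology (top_of_set Y) C = top_of_set C"
    using assms by (simp_all add: subtopology_subtopology Int_absorb1)
  moreover have "continuous_map (top_of_set X) (top_of_set Y) f"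
    using assms by (auto simp: continuous_map_in_subtopology)
  ultimately show ?thesis
    using fun_cong[OF naturality_hom_induced[of "top_of_set X" "top_of_set Y" f A C p], of w] assms
    by simp
qed

text \<open>The closed set \<open>X - B\<close> is excised; it lies in \<open>A\<close>, which is its own interior.\<close>
lemma excision_open_cover:
  assumes "openin (top_of_set X) A" "openin (top_of_set X) B" "A \<union> B = X"
  shows "hom_induced p (top_of_set B) (A \<inter> B) (top_of_set X) A id
    \<in> iso (relative_homology_group p (top_of_set B) (A \<inter> B)) (relative_homology_group p (top_of_set X) A)"
proof -
  have AX: "A \<subseteq> X" "B \<subseteq> X" using assms by auto
  have "closedin (top_of_set X) (X - B)"
    using assms(2) by (simp add: closedin_def Diff_Diff_Int AX Int_absorb1)
  then have "(top_of_set X) closure_of (X - B) \<subseteq> (top_of_set X) interior_of A"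
    using assms by (simp add: closure_of_closedin interior_of_openin) blast
  from homology_excision_axiom[OF this AX(1), of p]
  have *: "hom_induced p (subtopology (top_of_set X) (X - (X - B))) (A - (X - B)) (subtopology (top_of_set X) X) A id
    \<in> iso (relative_homology_group p (subtopology (top_of_set X) (X - (X - B))) (A - (X - B)))
          (relative_homology_group p (subtopology (top_of_set X) X) A)" .
  have e: "X - (X - B) = B" "A - (X - B) = A \<inter> B" using AX by auto
  then show ?thesis
    using * AX unfolding e by (simp add: subtopology_subtopology Int_absorb1)
qed

text \<open>The constant map \<open>X \<rightarrow> Q\<close> is a left inverse of the inclusion on \<open>H\<^sub>0\<close>.\<close>
lemma H0_path_connected_inj:
  assumes Q: "path_connected Q" and c: "c \<in> carrier (H 0 Q)" and QX: "Q \<subseteq> X"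
    and 1: "Hmap 0 Q X id c = \<one>\<^bsub>H 0 X\<^esub>"
  shows "c = \<one>\<^bsub>H 0 Q\<^esub>"
proof (cases "Q = {}")
  case True
  then show ?thesis
    using trivial_homology_group_empty[of "top_of_set Q" 0] c by (auto simp: trivial_group_def)
next
  case False
  then obtain q where q: "q \<in> Q" by blast
  have pc: "path_component_of (top_of_set Q) x y" if "x \<in> Q" "y \<in> Q" for x y
    using Q that by (simp add: path_connected_component)
  have "Hmap 0 Q Q id c = Hmap 0 Q Q (\<lambda>x. q) c"
    using q pc by (intro fun_cong[OF H0_map_eq_if_path_connected_pointwise]) auto
  also have "\<dots> = Hmap 0 X Q (\<lambda>x. q) (Hmap 0 Q X id c)"
    using q QX by (subst Hmap_comp) (auto simp: o_def)
  also have "\<dots> = \<one>\<^bsub>H 0 Q\<^esub>"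
    unfolding 1 by (rule hom_induced_one)
  finally show ?thesis
    using c by (simp add: hom_induced_id)
qed

section \<open>First homology of open covers\<close>

lemma relative_compose:
  assumes "continuous_on X f" "f \<in> X \<rightarrow> Y" "f \<in> A \<rightarrow> B" "continuous_on Y g" "g \<in> Y \<rightarrow> Z" "g \<in> B \<rightarrow> C"
  shows "hom_induced p (top_of_set Y) B (top_of_set Z) C g (hom_induced p (top_of_set X) A (top_of_set Y) B f c)
       = hom_induced p (top_of_set X) A (top_of_set Z) C (g \<circ> f) c"
  using assms by (intro hom_induced_compose') (auto simp: continuous_map_in_subtopology)

lemma excision_lift:
  assumes "openin (top_of_set X) A" "openin (top_of_set X) B" "A \<union> B = X"
    and "y \<in> carrier (relative_homology_group p (top_of_set X) A)"
  obtains w where "w \<in> carrier (relative_homology_group p (top_of_set B) (A \<inter> B))"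
    "hom_induced p (top_of_set B) (A \<inter> B) (top_of_set X) A id w = y"
proof -
  have "y \<in> hom_induced p (top_of_set B) (A \<inter> B) (top_of_set X) A id `
      carrier (relative_homology_group p (top_of_set B) (A \<inter> B))"
    using excision_open_cover[OF assms(1-3), of p] assms(4) by (simp add: iso_def bij_betw_def)
  then show thesis using that by blast
qed

lemma excision_one:
  assumes "openin (top_of_set X) A" "openin (top_of_set X) B" "A \<union> B = X"
    and "w \<in> carrier (relative_homology_group p (top_of_set B) (A \<inter> B))"
    and "hom_induced p (top_of_set B) (A \<inter> B) (top_of_set X) A id w
      = \<one>\<^bsub>relative_homology_group p (top_of_set X) A\<^esub>"
  shows "w = \<one>\<^bsub>relative_homology_group p (top_of_set B) (A \<inter> B)\<^esub>"
proof -
  have "inj_on (hom_induced p (top_of_set B) (A \<inter> B) (top_of_set X) A id)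
      (carrier (relative_homology_group p (top_of_set B) (A \<inter> B)))"
    using excision_open_cover[OF assms(1-3), of p] by (simp add: iso_def bij_betw_def)
  then show ?thesis
    by (rule inj_onD) (use assms in \<open>simp_all add: hom_induced_one group.is_monoid\<close>)
qed

text \<open>The end of the Mayer--Vietoris sequence, in a form that allows the intersection to be disconnected.
  A class of \<open>X\<close> is first made relative to \<open>A\<close> and excised into \<open>(B, A \<inter> B)\<close>.  Its boundary lies in
  \<open>A \<inter> B\<close> and has total multiplicity zero, so it bounds in the path-connected set \<open>Q\<close>; hence the relative
  class closes up to an absolute class of \<open>B \<union> Q\<close>.  With \<open>Q = A \<inter> B\<close> this is the usual surjectivity.\<close>
lemma H1_sum_of_open_cover:
  assumes cover: "openin (top_of_set X) A" "openin (top_of_set X) B" "A \<union> B = X"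
    and Q: "A \<inter> B \<subseteq> Q" "Q \<subseteq> A" "path_connected Q"
    and x: "x \<in> carrier (H 1 X)"
  obtains a b where "a \<in> carrier (H 1 A)" "b \<in> carrier (H 1 (B \<union> Q))"
    "x = Hmap 1 A X id a \<otimes>\<^bsub>H 1 X\<^esub> Hmap 1 (B \<union> Q) X id b"
proof -
  let ?j = "hom_induced 1 (top_of_set X) {} (top_of_set X) A id"
  let ?R = "relative_homology_group 1 (top_of_set X) A"
  let ?e = "hom_induced 1 (top_of_set B) (A \<inter> B) (top_of_set X) A id"
  have AX: "A \<subseteq> X" "B \<subseteq> X" "B \<union> Q \<subseteq> X" using cover Q by auto
  have "?j x \<in> carrier ?R" by (rule hom_induced_carrier)
  then obtain w where w: "?e w = ?j x"
    using excision_lift[OF cover] by blast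
  define w' where "w' = hom_induced 1 (top_of_set B) (A \<inter> B) (top_of_set (B \<union> Q)) Q id w"
  have w': "w' \<in> carrier (relative_homology_group 1 (top_of_set (B \<union> Q)) Q)"
    unfolding w'_def by (rule hom_induced_carrier)
  have sub: "subtopology (top_of_set (B \<union> Q)) Q = top_of_set Q"
    by (simp add: subtopology_subtopology Int_absorb1)
  \<comment> \<open>On a path-connected \<open>Q\<close> a 0-class that bounds in \<open>B \<union> Q\<close> is zero.\<close>
  have "hom_boundary 1 (top_of_set (B \<union> Q)) Q w' = \<one>\<^bsub>H 0 Q\<^esub>"
  proof (rule H0_path_connected_inj[OF Q(3), where X = "B \<union> Q"])
    show "hom_boundary 1 (top_of_set (B \<union> Q)) Q w' \<in> carrier (H 0 Q)"
      using hom_boundary_carrier[of 1 "top_of_set (B \<union> Q)" Q w'] sub by simp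
  qed (use exact_boundary_trivial[OF _ w'] in auto)
  then obtain b where b: "b \<in> carrier (H 1 (B \<union> Q))"
     "w' = hom_induced 1 (top_of_set (B \<union> Q)) {} (top_of_set (B \<union> Q)) Q id b"
    using exact_relative[OF _ w'] by auto
  let ?b = "Hmap 1 (B \<union> Q) X id b"
  have bc: "?b \<in> carrier (H 1 X)" by (rule Hmap_carrier)
  have "?j ?b = hom_induced 1 (top_of_set (B \<union> Q)) {} (top_of_set X) A id b"
    using AX by (subst relative_compose) auto
  also have "\<dots> = hom_induced 1 (top_of_set (B \<union> Q)) Q (top_of_set X) A id w'"
    unfolding b using AX Q by (subst relative_compose) auto
  also have "\<dots> = ?e w"
    unfolding w'_def using AX Q by (subst relative_compose) auto
  finally have jb: "?j ?b = ?j x" using w by simp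
  interpret X: group "H 1 X" by simp
  interpret R: group ?R by simp
  interpret j: group_hom "H 1 X" ?R ?j
    by (simp add: group_hom_def group_hom_axioms_def hom_induced_hom)
  have "?j (x \<otimes>\<^bsub>H 1 X\<^esub> inv\<^bsub>H 1 X\<^esub> ?b) = \<one>\<^bsub>?R\<^esub>"
    using x bc jb by simp
  then obtain a where a: "a \<in> carrier (H 1 A)" "x \<otimes>\<^bsub>H 1 X\<^esub> inv\<^bsub>H 1 X\<^esub> ?b = Hmap 1 A X id a"
    using exact_absolute[OF AX(1)] x bc by (metis X.inv_closed X.m_closed)
  have "x = x \<otimes>\<^bsub>H 1 X\<^esub> inv\<^bsub>H 1 X\<^esub> ?b \<otimes>\<^bsub>H 1 X\<^esub> ?b"
    using x bc by (simp add: X.m_assoc)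
  then show thesis
    using that a b by simp
qed

text \<open>Under excision the obstruction to coming from \<open>A\<close> is a class of \<open>(B, A \<inter> B)\<close>.  Its boundary is compared
  with the boundary of its image in \<open>(D, C \<inter> D)\<close>, which vanishes with the image of \<open>x\<close> in \<open>Y\<close>.  So the class
  lifts to \<open>B\<close>, and there it can be pushed into \<open>A \<inter> B\<close>.\<close>
lemma H1_class_from_open_part:
  assumes X: "openin (top_of_set X) A" "openin (top_of_set X) B" "A \<union> B = X"
    and Y: "openin (top_of_set Y) C" "openin (top_of_set Y) D" "C \<union> D = Y"
    and p: "continuous_on X p" "p \<in> A \<rightarrow> C" "p \<in> B \<rightarrow> D"
    and inj: "\<And>c. c \<in> carrier (H 0 (A \<inter> B)) \<Longrightarrow> Hmap 0 (A \<inter> B) (C \<inter> D) p c = \<one>\<^bsub>H 0 (C \<inter> D)\<^esub> \<Longrightarrow>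
        c = \<one>\<^bsub>H 0 (A \<inter> B)\<^esub>"
    and surj: "carrier (H 1 B) \<subseteq> Hmap 1 (A \<inter> B) B id ` carrier (H 1 (A \<inter> B))"
    and x: "x \<in> carrier (H 1 X)" "Hmap 1 X Y p x = \<one>\<^bsub>H 1 Y\<^esub>"
  obtains a where "a \<in> carrier (H 1 A)" "x = Hmap 1 A X id a"
proof -
  let ?j = "hom_induced 1 (top_of_set X) {} (top_of_set X) A id"
  let ?j' = "hom_induced 1 (top_of_set Y) {} (top_of_set Y) C id"
  let ?R = "relative_homology_group 1 (top_of_set X) A"
  let ?e = "hom_induced 1 (top_of_set B) (A \<inter> B) (top_of_set X) A id"
  let ?e' = "hom_induced 1 (top_of_set D) (C \<inter> D) (top_of_set Y) C id"
  have AX: "A \<subseteq> X" "B \<subseteq> X" "C \<subseteq> Y" "D \<subseteq> Y" using X Y by auto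
  have pXY: "p \<in> X \<rightarrow> Y" using X Y p by auto
  have "?j x \<in> carrier ?R" by (rule hom_induced_carrier)
  then obtain w where w: "?e w = ?j x" "w \<in> carrier (relative_homology_group 1 (top_of_set B) (A \<inter> B))"
    using excision_lift[OF X] by blast
  have pB: "continuous_on B p" using p AX continuous_on_subset by blast
  define w' where "w' = hom_induced 1 (top_of_set B) (A \<inter> B) (top_of_set D) (C \<inter> D) p w"
  have w'c: "w' \<in> carrier (relative_homology_group 1 (top_of_set D) (C \<inter> D))"
    unfolding w'_def by (rule hom_induced_carrier)
  have "?e' w' = hom_induced 1 (top_of_set B) (A \<inter> B) (top_of_set Y) C p w"
    unfolding w'_def using AX p pB by (subst relative_compose) auto
  also have "\<dots> = hom_induced 1 (top_of_set X) A (top_of_set Y) C p (?e w)"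
    using AX p pXY by (subst relative_compose) auto
  also have "\<dots> = hom_induced 1 (top_of_set X) {} (top_of_set Y) C p x"
    unfolding w using AX p pXY by (subst relative_compose) auto
  also have "\<dots> = ?j' (Hmap 1 X Y p x)"
    using AX p pXY by (subst relative_compose) auto
  also have "\<dots> = \<one>\<^bsub>relative_homology_group 1 (top_of_set Y) C\<^esub>"
    unfolding x by (rule hom_induced_one)
  finally have w'1: "w' = \<one>\<^bsub>relative_homology_group 1 (top_of_set D) (C \<inter> D)\<^esub>"
    by (rule excision_one[OF Y w'c])
  have sub: "subtopology (top_of_set B) (A \<inter> B) = top_of_set (A \<inter> B)"
     "subtopology (top_of_set D) (C \<inter> D) = top_of_set (C \<inter> D)"
    by (simp_all add: subtopology_subtopology Int_absorb1)
  have "hom_boundary 1 (top_of_set B) (A \<inter> B) w = \<one>\<^bsub>H 0 (A \<inter> B)\<^esub>"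
  proof (rule inj)
    show "hom_boundary 1 (top_of_set B) (A \<inter> B) w \<in> carrier (H 0 (A \<inter> B))"
      using hom_boundary_carrier[of 1 "top_of_set B" "A \<inter> B" w] sub by simp
    have "Hmap 0 (A \<inter> B) (C \<inter> D) p (hom_boundary 1 (top_of_set B) (A \<inter> B) w)
      = hom_boundary 1 (top_of_set D) (C \<inter> D) w'"
      unfolding w'_def using p pB by (subst boundary_natural) auto
    also have "\<dots> = \<one>\<^bsub>H 0 (C \<inter> D)\<^esub>"
      unfolding w'1 using hom_boundary_one[of 1 "top_of_set D" "C \<inter> D"] sub by simp
    finally show "Hmap 0 (A \<inter> B) (C \<inter> D) p (hom_boundary 1 (top_of_set B) (A \<inter> B) w) = \<one>\<^bsub>H 0 (C \<inter> D)\<^esub>" .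
  qed
  then obtain b where b: "b \<in> carrier (H 1 B)"
     "w = hom_induced 1 (top_of_set B) {} (top_of_set B) (A \<inter> B) id b"
    using exact_relative[OF _ w(2)] by auto
  obtain d where d: "d \<in> carrier (H 1 (A \<inter> B))" "b = Hmap 1 (A \<inter> B) B id d"
    using surj b by blast
  have "w = \<one>\<^bsub>relative_homology_group 1 (top_of_set B) (A \<inter> B)\<^esub>"
    unfolding b d(2) using d(1) by (intro exact_absolute_trivial) auto
  then have "?j x = \<one>\<^bsub>?R\<^esub>"
    using w(1) hom_induced_one by metis
  then show thesis
    using exact_absolute[OF AX(1) x(1)] that by blast
qed

text \<open>Used to see that path components stay distinct: \<open>h\<close> only has to return to the right path component.\<close>
lemma H0_map_inj_if_left_inverse:
  assumes "continuous_on S f" "f \<in> S \<rightarrow> T" "continuous_on T h" "h \<in> T \<rightarrow> S"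
    and pc: "\<And>x. x \<in> S \<Longrightarrow> path_component S x (h (f x))"
    and c: "c \<in> carrier (H 0 S)" "Hmap 0 S T f c = \<one>\<^bsub>H 0 T\<^esub>"
  shows "c = \<one>\<^bsub>H 0 S\<^esub>"
proof -
  have "Hmap 0 S S id c = Hmap 0 S S (h \<circ> f) c"
  proof (rule fun_cong[OF H0_map_eq_if_path_connected_pointwise])
    show "continuous_map (top_of_set S) (top_of_set S) (h \<circ> f)"
      using assms continuous_on_compose[OF assms(1) continuous_on_subset[OF assms(3)]]
      by (auto simp: continuous_map_in_subtopology o_def)
  qed (use pc in auto)
  also have "\<dots> = Hmap 0 T S h (Hmap 0 S T f c)"
    using assms by (subst Hmap_comp) auto
  also have "\<dots> = \<one>\<^bsub>H 0 S\<^esub>"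
    unfolding c by (rule hom_induced_one)
  finally show ?thesis
    using c by (simp add: hom_induced_id)
qed

section \<open>Coordinates and segments\<close>

lemma continuous_on_coordinate [continuous_intros]:
  "continuous_on S (\<lambda>z. z i)"
  by (rule continuous_on_product_then_coordinatewise) (rule continuous_on_id)

lemma continuous_on_fst_coordinate [continuous_intros]:
  "continuous_on S g \<Longrightarrow> continuous_on S (\<lambda>z. fst (g z) i)"
  by (rule continuous_on_product_then_coordinatewise) (rule continuous_on_fst)

lemma continuous_on_snd_coordinate [continuous_intros]:
  "continuous_on S g \<Longrightarrow> continuous_on S (\<lambda>z. snd (g z) i)"
  by (rule continuous_on_product_then_coordinatewise) (rule continuous_on_snd)

lemma openin_superlevel:
  fixes g :: "'a::topological_space \<Rightarrow> real"
  assumes "continuous_on S g"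
  shows "openin (top_of_set S) {z \<in> S. g z > c}"
  using continuous_openin_preimage_gen[OF assms, of "{c<..}"]
  by (simp add: vimage_def Int_def conj_commute)

lemma closedin_superlevel:
  fixes g :: "'a::topological_space \<Rightarrow> real"
  assumes "continuous_on S g"
  shows "closedin (top_of_set S) {z \<in> S. g z \<ge> c}"
  using continuous_closedin_preimage[OF assms, of "{c..}"]
  by (simp add: vimage_def Int_def conj_commute)

definition segment_point :: "real \<Rightarrow> ('i \<Rightarrow> real) \<Rightarrow> ('i \<Rightarrow> real) \<Rightarrow> 'i \<Rightarrow> real" where
  "segment_point s f g = (\<lambda>i. (1 - s) * f i + s * g i)"

lemma segment_point_ends [simp]: "segment_point 0 f g = f" "segment_point 1 f g = g"
  by (auto simp: segment_point_def)

lemma segment_point_same [simp]: "segment_point s f f = f"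
  by (auto simp: segment_point_def algebra_simps)

lemma continuous_on_segment_point [continuous_intros]:
  assumes "continuous_on S a" "continuous_on S f" "continuous_on S g"
  shows "continuous_on S (\<lambda>z. segment_point (a z) (f z) (g z))"
  unfolding segment_point_def
  by (intro continuous_on_coordinatewise_then_product continuous_intros assms(1)
      continuous_on_product_then_coordinatewise[OF assms(2)] continuous_on_product_then_coordinatewise[OF assms(3)])

lemma continuous_on_if_closed_pieces:
  assumes "closedin (top_of_set S) {x \<in> S. P x}" "closedin (top_of_set S) {x \<in> S. Q x}"
    and "continuous_on {x \<in> S. P x} f" "continuous_on {x \<in> S. Q x} g"
    and "\<And>x. x \<in> S \<Longrightarrow> P x \<or> Q x" "\<And>x. x \<in> S \<Longrightarrow> P x \<Longrightarrow> Q x \<Longrightarrow> f x = g x"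
  shows "continuous_on S (\<lambda>x. if P x then f x else g x)"
proof -
  let ?P = "{x \<in> S. P x}" and ?Q = "{x \<in> S. Q x}"
  have S: "?P \<union> ?Q = S" using assms(5) by auto
  have "continuous_on (?P \<union> ?Q) (\<lambda>x. if P x then f x else g x)"
  proof (rule continuous_on_cases_local)
    show "closedin (top_of_set (?P \<union> ?Q)) ?P" "closedin (top_of_set (?P \<union> ?Q)) ?Q"
      unfolding S by fact+
  qed (use assms(3,4,6) in auto)
  then show ?thesis unfolding S .
qed

section \<open>A graph with a distinguished edge\<close>

text \<open>The properties of barycentric coordinates on the realization \<open>X\<close> of a graph with an edge
  \<open>{u, v}\<close>.  At most two coordinates of a point are nonzero, so the points with both \<open>u\<close>- and
  \<open>v\<close>-coordinate positive are exactly those inside that edge.\<close>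
locale edge_attachment =
  fixes X :: "('v \<Rightarrow> real) set" and u v :: 'v
  assumes uv: "u \<noteq> v"
    and nonneg: "f \<in> X \<Longrightarrow> 0 \<le> f i"
    and sum_le_1: "f \<in> X \<Longrightarrow> f u + f v \<le> 1"
    and edge_disj: "f \<in> X \<Longrightarrow> f u > 0 \<Longrightarrow> f v > 0 \<Longrightarrow> f u + f v = 1"
    and edge_rest: "f \<in> X \<Longrightarrow> f u + f v = 1 \<Longrightarrow> i \<noteq> u \<Longrightarrow> i \<noteq> v \<Longrightarrow> f i = 0"
    and edge_in: "0 \<le> a \<Longrightarrow> a \<le> 1 \<Longrightarrow> (\<lambda>i. if i = u then a else if i = v then 1 - a else 0) \<in> X"
begin

definition edge_point :: "real \<Rightarrow> 'v \<Rightarrow> real" where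
  "edge_point a = (\<lambda>i. if i = u then a else if i = v then 1 - a else 0)"

definition end_u where "end_u = edge_point 1"
definition end_v where "end_v = edge_point 0"
text \<open>\<open>Old\<close> is the graph without the open edge; \<open>Near\<close> is the complement of the midpoint of the edge and
  retracts onto \<open>Old\<close>.\<close>
definition "Old = {f \<in> X. f u = 0 \<or> f v = 0}"
definition "Open_edge = {f \<in> X. f u > 0 \<and> f v > 0}"
definition "Near = {f \<in> X. f u + f v < 1 \<or> f u > 1/2 \<or> f v > 1/2}"

lemma edge_point_simps [simp]: "edge_point a u = a" "edge_point a v = 1 - a"
  using uv by (auto simp: edge_point_def)

lemma edge_point_in_X [simp]: "0 \<le> a \<Longrightarrow> a \<le> 1 \<Longrightarrow> edge_point a \<in> X"
  using edge_in by (simp add: edge_point_def)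

lemma end_u_simps [simp]: "end_u u = 1" "end_u v = 0" and end_v_simps [simp]: "end_v u = 0" "end_v v = 1"
  by (auto simp: end_u_def end_v_def)

lemma on_edge: "f \<in> X \<Longrightarrow> f u + f v = 1 \<Longrightarrow> f = edge_point (f u)"
  using edge_rest by (auto simp: edge_point_def fun_eq_iff)

lemma end_u_iff: "f \<in> X \<Longrightarrow> f = end_u \<longleftrightarrow> f u = 1"
  using on_edge[of f] nonneg[of f v] sum_le_1[of f] by (auto simp: end_u_def)

lemma end_v_iff: "f \<in> X \<Longrightarrow> f = end_v \<longleftrightarrow> f v = 1"
  using on_edge[of f] nonneg[of f u] sum_le_1[of f] by (auto simp: end_v_def)

lemma ends_in [simp]: "end_u \<in> X" "end_v \<in> X" "end_u \<in> Old" "end_v \<in> Old" "end_u \<noteq> end_v" "end_v \<noteq> end_u"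
proof -
  show "end_u \<in> X" "end_v \<in> X" "end_u \<in> Old" "end_v \<in> Old"
    by (auto simp: end_u_def end_v_def Old_def)
  have "end_u u \<noteq> end_v u" by simp
  then show "end_u \<noteq> end_v" "end_v \<noteq> end_u" by metis+
qed

lemma part_inclusions: "Old \<subseteq> X" "Old \<subseteq> Near" "Near \<union> Open_edge = X" "Open_edge \<subseteq> X" "Near \<subseteq> X" "Old \<inter> Open_edge = {}"
proof -
  show "Old \<subseteq> Near"
  proof
    fix f assume "f \<in> Old"
    then show "f \<in> Near" using sum_le_1[of f] by (auto simp: Old_def Near_def)
  qed
  show "Near \<union> Open_edge = X"
    using nonneg sum_le_1 by (force simp: Near_def Open_edge_def)
qed (auto simp: Old_def Open_edge_def Near_def)

lemma Old_iff: "f \<in> X \<Longrightarrow> f \<in> Old \<longleftrightarrow> \<not> (f u > 0 \<and> f v > 0)"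
  using nonneg[of f u] nonneg[of f v] by (auto simp: Old_def)

lemma Old_iff_not_Open_edge: "f \<in> X \<Longrightarrow> f \<in> Old \<longleftrightarrow> f \<notin> Open_edge"
  by (simp add: Old_iff Open_edge_def)

lemma segment_edge:
  assumes "0 \<le> s" "s \<le> 1" "f = edge_point (f u)" "g = edge_point (g u)"
  shows "segment_point s f g = edge_point ((1 - s) * f u + s * g u)"
  by (subst assms(3), subst assms(4)) (auto simp: segment_point_def edge_point_def algebra_simps fun_eq_iff)

lemma Open_edge_eq: "f \<in> Open_edge \<Longrightarrow> f = edge_point (f u)"
  using on_edge edge_disj by (auto simp: Open_edge_def)

lemma end_u_eq: "end_u = edge_point (end_u u)" and end_v_eq: "end_v = edge_point (end_v u)"
  by (simp_all add: end_u_def end_v_def)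

lemma continuous_on_edge_point [continuous_intros]:
  assumes "continuous_on S a"
  shows "continuous_on S (\<lambda>z. edge_point (a z))"
  unfolding edge_point_def
proof (rule continuous_on_coordinatewise_then_product)
  fix i
  show "continuous_on S (\<lambda>x. if i = u then a x else if i = v then 1 - a x else 0)"
    by (cases "i = u"; cases "i = v") (auto intro!: continuous_intros assms)
qed

text \<open>The retraction of \<open>Near\<close> onto \<open>Old\<close>.  It is continuous on \<open>Near\<close> only: at the midpoint it jumps.\<close>
definition collapse where
  "collapse f = (if f u = 0 \<or> f v = 0 then f else if f u > 1/2 then end_u else end_v)"

lemma collapse_in_Old: "f \<in> X \<Longrightarrow> collapse f \<in> Old"
  by (auto simp: collapse_def Old_def)

lemma collapse_Old: "f \<in> Old \<Longrightarrow> collapse f = f"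
  by (auto simp: collapse_def Old_def)

lemma continuous_on_collapse: "continuous_on Near collapse"
proof -
  have pos: "f u \<ge> 0" "f v \<ge> 0" if "f \<in> Near" for f
    using that nonneg by (auto simp: Near_def)
  have c: "continuous_on S (\<lambda>f::'v \<Rightarrow> real. f i)" for S i
    by (intro continuous_intros continuous_on_id)
  have 1: "{f \<in> Near. f u = 0 \<or> f v = 0} = {f \<in> Near. - (f u * f v) \<ge> 0}"
  proof -
    have "f u = 0 \<or> f v = 0 \<longleftrightarrow> - (f u * f v) \<ge> 0" if "f \<in> Near" for f
      using mult_nonneg_nonneg[OF pos[OF that]] by (auto simp: antisym)
    then show ?thesis by blast
  qed
  have 2: "closedin (top_of_set Near) {f \<in> Near. f u + f v \<ge> 1}"
    by (intro closedin_superlevel continuous_intros c)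
  have E: "continuous_on {f \<in> Near. f u + f v \<ge> 1} (\<lambda>f. if f u \<ge> 1/2 then end_u else end_v)"
  proof (rule continuous_on_if_closed_pieces[where Q = "\<lambda>f. f v \<ge> 1/2"])
    show "closedin (top_of_set {f \<in> Near. f u + f v \<ge> 1}) {f \<in> {f \<in> Near. f u + f v \<ge> 1}. f u \<ge> 1/2}"
      "closedin (top_of_set {f \<in> Near. f u + f v \<ge> 1}) {f \<in> {f \<in> Near. f u + f v \<ge> 1}. f v \<ge> 1/2}"
      by (intro closedin_superlevel c)+
  qed (use sum_le_1 in \<open>force simp: Near_def\<close>)+
  have "continuous_on Near (\<lambda>f. if f u = 0 \<or> f v = 0 then f else if f u \<ge> 1/2 then end_u else end_v)"
  proof (rule continuous_on_if_closed_pieces[where Q = "\<lambda>f. f u + f v \<ge> 1"])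
    show "closedin (top_of_set Near) {f \<in> Near. f u = 0 \<or> f v = 0}"
      unfolding 1 by (intro closedin_superlevel continuous_intros c)
    show "(f u = 0 \<or> f v = 0) \<or> 1 \<le> f u + f v" if "f \<in> Near" for f
      using that edge_disj[of f] pos[OF that] by (force simp: Near_def)
    show "f = (if 1/2 \<le> f u then end_u else end_v)" if "f \<in> Near" "f u = 0 \<or> f v = 0" "1 \<le> f u + f v" for f
      using that end_u_iff[of f] end_v_iff[of f] sum_le_1[of f] by (auto simp: Near_def)
  qed (use 2 E in auto)
  then show ?thesis
  proof (rule continuous_on_eq)
    fix f assume f: "f \<in> Near"
    then show "(if f u = 0 \<or> f v = 0 then f else if f u \<ge> 1/2 then end_u else end_v) = collapse f"
      using edge_disj[of f] pos[OF f] by (force simp: collapse_def Near_def)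
  qed
qed

text \<open>Both ends of the segment from \<open>f\<close> to \<open>collapse f\<close> lie on the edge, so the segment is a path in the
  edge.\<close>
lemma collapse_edge:
  assumes "f \<in> X" "f \<notin> Old"
  shows "f = edge_point (f u)" "collapse f = edge_point (collapse f u)"
proof -
  show "f = edge_point (f u)" using assms Open_edge_eq[of f] Old_iff_not_Open_edge[of f] by blast
  have "collapse f = end_u \<or> collapse f = end_v" using assms by (auto simp: collapse_def Old_def)
  then show "collapse f = edge_point (collapse f u)" using end_u_eq end_v_eq by metis
qed

lemma segment_collapse_in_X:
  assumes "f \<in> X" "0 \<le> s" "s \<le> 1"
  shows "segment_point s f (collapse f) \<in> X"
proof (cases "f \<in> Old")
  case True
  then show ?thesis using assms by (simp add: collapse_Old)
next
  case False
  have "0 \<le> f u" "f u \<le> 1" "0 \<le> collapse f u" "collapse f u \<le> 1"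
    using nonneg[of f u] nonneg[of f v] sum_le_1[of f] assms by (auto simp: collapse_def)
  then show ?thesis
    unfolding segment_edge[OF assms(2,3) collapse_edge[OF assms(1) False]]
    using assms convex_bound_le[of "f u" 1 "collapse f u" "1 - s" s] by simp
qed

text \<open>Sliding the second particle along the edge to its nearer end moves \<open>M\<close> into the pairs over the old
  graph.  The intermediate pairs have to stay in \<open>T\<close> but may leave \<open>M\<close>, and \<open>T\<close> will be a product or a
  space of distinct pairs.\<close>
lemma collar_homology:
  assumes M: "M \<subseteq> Z \<times> Near" "M \<subseteq> T" "T \<subseteq> Z \<times> X"
    and push: "\<And>x y s. (x, y) \<in> M \<Longrightarrow> 0 \<le> s \<Longrightarrow> s \<le> 1 \<Longrightarrow> (x, segment_point s y (collapse y)) \<in> T"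
    and a: "a \<in> carrier (H p M)"
  shows "\<exists>a0 \<in> carrier (H p (T \<inter> Z \<times> Old)). Hmap p M T id a = Hmap p (T \<inter> Z \<times> Old) T id a0"
proof
  let ?r = "\<lambda>z. (fst z, collapse (snd z))"
  have cr: "continuous_on M (\<lambda>z. collapse (snd z))"
    using M by (intro continuous_on_compose2[OF continuous_on_collapse] continuous_intros) auto
  have r0: "?r \<in> M \<rightarrow> T \<inter> Z \<times> Old"
  proof
    fix z assume z: "z \<in> M"
    then have "snd z \<in> X" "fst z \<in> Z" using M by auto
    then show "?r z \<in> T \<inter> Z \<times> Old"
      using push[of "fst z" "snd z" 1] z collapse_in_Old by auto
  qed
  let ?h = "\<lambda>w::real \<times> _. (fst (snd w), segment_point (fst w) (snd (snd w)) (collapse (snd (snd w))))"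
  have "Hmap p M T (\<lambda>z. ?h (0, z)) = Hmap p M T (\<lambda>z. ?h (1, z))"
  proof (rule Hmap_homotopic)
    show "continuous_on ({0..1} \<times> M) ?h"
      using cr by (intro continuous_intros continuous_on_compose2[OF cr, of _ snd]) auto
    show "?h \<in> {0..1} \<times> M \<rightarrow> T"
      using push by auto
  qed
  moreover have "Hmap p M T (\<lambda>z. ?h (0, z)) = Hmap p M T id"
    by (rule Hmap_cong) simp
  ultimately have "Hmap p M T id a = Hmap p M T ?r a"
    by simp
  also have "\<dots> = Hmap p (T \<inter> Z \<times> Old) T id (Hmap p M (T \<inter> Z \<times> Old) ?r a)"
    using r0 by (subst Hmap_comp) (auto simp: o_def intro!: continuous_intros cr)
  finally show "Hmap p M T id a = Hmap p (T \<inter> Z \<times> Old) T id (Hmap p M (T \<inter> Z \<times> Old) ?r a)" .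
qed (rule Hmap_carrier)

end

context edge_attachment
begin

text \<open>The ends of the edge play symmetric roles; facts about one end are transferred to the other by this
  interpretation.\<close>
lemma swap: "edge_attachment X v u"
proof
  show "v \<noteq> u" using uv by simp
  show "(\<lambda>i. if i = v then a else if i = u then 1 - a else 0) \<in> X" if "0 \<le> a" "a \<le> 1" for a
  proof -
    have "(\<lambda>i. if i = v then a else if i = u then 1 - a else 0) = edge_point (1 - a)"
      using uv by (auto simp: edge_point_def)
    then show ?thesis using that by simp
  qed
qed (use nonneg sum_le_1 edge_disj edge_rest in \<open>auto simp: add.commute\<close>)

lemma swap_simps:
  "edge_attachment.Old X v u = Old" "edge_attachment.Open_edge X v u = Open_edge"
  "edge_attachment.end_u v u = end_v" "edge_attachment.end_v v u = end_u"
proof -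
  interpret sw: edge_attachment X v u by (rule swap)
  show "sw.Old = Old" by (auto simp: sw.Old_def Old_def)
  show "sw.Open_edge = Open_edge" by (auto simp: sw.Open_edge_def Open_edge_def)
  have "sw.edge_point a = edge_point (1 - a)" for a
    using uv by (auto simp: edge_point_def sw.edge_point_def)
  then show "sw.end_u = end_v" "sw.end_v = end_u" by (simp_all add: sw.end_u_def sw.end_v_def end_u_def end_v_def)
qed

section \<open>Pairs with second point near or inside the edge\<close>

text \<open>The second particle is inside the edge and closer to \<open>end_u\<close> than half the distance of the first
  particle from \<open>end_u\<close>, where the distance of \<open>x\<close> is measured by \<open>1 - x u\<close>.  The factor one half makes
  the corners at the two ends disjoint.\<close>
definition Corner where "Corner Z = {z \<in> Z \<times> Open_edge. 2 * snd z u > 1 + fst z u}"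

lemma edge_point_in_Open_edge [simp]: "0 < a \<Longrightarrow> a < 1 \<Longrightarrow> edge_point a \<in> Open_edge"
  by (simp add: Open_edge_def)

lemma less_1_if_not_end_u: "x \<in> X \<Longrightarrow> x \<noteq> end_u \<Longrightarrow> x u < 1"
  using sum_le_1[of x] nonneg[of x v] end_u_iff[of x] by linarith

text \<open>The corner is a family of intervals over the first particle, whose lengths \<open>(1 - x u) / 2\<close> shrink to
  zero at the end of the edge.\<close>
lemma Corner_path_connected:
  assumes "Z \<subseteq> X" "path_connected (Z - {end_u})"
  shows "path_connected (Corner Z)"
proof -
  let ?g = "\<lambda>w. (fst w, edge_point (1 - snd w * (1 - fst w u) / 2))"
  have "continuous_on ((Z - {end_u}) \<times> {0<..<1}) ?g"
    by (intro continuous_intros) auto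
  then have "path_connected (?g ` ((Z - {end_u}) \<times> {0<..<1::real}))"
    using assms by (intro path_connected_continuous_image path_connected_Times)
       (auto intro: convex_imp_path_connected)
  also have "?g ` ((Z - {end_u}) \<times> {0<..<1::real}) = Corner Z"
  proof (intro equalityI subsetI)
    fix w assume "w \<in> ?g ` ((Z - {end_u}) \<times> {0<..<1::real})"
    then obtain z where z: "z \<in> (Z - {end_u}) \<times> {0<..<1::real}" "w = ?g z" by blast
    obtain x s where "z = (x, s)" by (cases z)
    with z have w: "w = (x, edge_point (1 - s * (1 - x u) / 2))" "x \<in> Z" "x \<noteq> end_u" "0 < s" "s < 1"
      by auto
    have x: "0 \<le> x u" "x u < 1" using w assms nonneg[of x u] less_1_if_not_end_u by auto
    define t where "t = s * (1 - x u)"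
    have "0 < t" using w x by (simp add: t_def)
    moreover have "t < 1 * (1 - x u)" unfolding t_def using w x by (intro mult_strict_right_mono) auto
    ultimately have "edge_point (1 - t / 2) \<in> Open_edge" "2 * (1 - t / 2) > 1 + x u"
      using x by (auto intro!: edge_point_in_Open_edge)
    then show "w \<in> Corner Z"
      using w by (auto simp: Corner_def t_def)
  next
    fix w assume w: "w \<in> Corner Z"
    obtain x y where xy: "w = (x, y)" by (cases w)
    have y: "y \<in> Open_edge" "2 * y u > 1 + x u" "x \<in> Z" using w xy by (auto simp: Corner_def)
    then have y1: "y u < 1" using edge_disj[of y] by (auto simp: Open_edge_def)
    then have xu: "x u < 1" using y by simp
    then have "x \<noteq> end_u" by auto
    define s where "s = 2 * (1 - y u) / (1 - x u)"
    have "0 < s" "s < 1" using y y1 xu by (auto simp: s_def divide_simps)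
    moreover have "y = edge_point (1 - s * (1 - x u) / 2)"
    proof -
      have "1 - s * (1 - x u) / 2 = y u" using xu by (simp add: s_def field_simps)
      then show ?thesis using Open_edge_eq[OF y(1)] by simp
    qed
    ultimately show "w \<in> ?g ` ((Z - {end_u}) \<times> {0<..<1::real})"
      using xy y \<open>x \<noteq> end_u\<close> by (intro image_eqI[of _ _ "(x, s)"]) auto
  qed
  finally show ?thesis .
qed

text \<open>Half of the available length gives a second particle depending continuously on the first.\<close>
lemma Corner_section:
  assumes "Old \<subseteq> Z" "Z \<subseteq> X"
  obtains \<sigma> where "continuous_on (Old - {end_u}) \<sigma>" "\<sigma> \<in> Old - {end_u} \<rightarrow> Corner Z" "\<And>x. fst (\<sigma> x) = x"
proof
  let ?\<sigma> = "\<lambda>x. (x, edge_point (1 - (1 - x u) / 4))"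
  show "continuous_on (Old - {end_u}) ?\<sigma>"
    by (intro continuous_intros) auto
  show "?\<sigma> \<in> Old - {end_u} \<rightarrow> Corner Z"
  proof
    fix x assume x: "x \<in> Old - {end_u}"
    then have "0 \<le> x u" "x u < 1" "x \<in> Z" using assms part_inclusions nonneg[of x u] less_1_if_not_end_u[of x] by auto
    moreover from this have "1 + x u < 2 * (1 - (1 - x u) / 4)"
      by (simp add: field_simps)
    ultimately show "?\<sigma> x \<in> Corner Z"
      by (auto simp: Corner_def intro!: edge_point_in_Open_edge)
  qed
qed auto

text \<open>The position of the first particle after it has been pushed off the open edge, away from the second
  particle.\<close>
definition slide where "slide z = (if fst z \<in> Old then fst z else if fst z u > snd z u then end_u else end_v)"

text \<open>\<open>Z\<close> is the set in which the first particle moves; it will be the old graph or all of \<open>X\<close>.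
  \<open>Conf_near\<close> is an open neighbourhood of \<open>Conf_old\<close> in \<open>Conf\<close> from which the second particle can
  retreat to the old graph without meeting the first one.\<close>
definition Conf where "Conf Z = {z \<in> Z \<times> X. fst z \<noteq> snd z}"
definition Conf_old where "Conf_old Z = {z \<in> Z \<times> Old. fst z \<noteq> snd z}"
definition Conf_near where "Conf_near Z = {z \<in> Conf Z. snd z u + snd z v < 1 \<or> 2 * snd z u > 1 + fst z u \<or> 2 * snd z v > 1 + fst z v}"
definition Conf_edge where "Conf_edge Z = {z \<in> Conf Z. snd z \<in> Open_edge}"

lemma slide_in_Old: "z \<in> Conf_edge Z \<Longrightarrow> slide z \<in> Old"
  by (auto simp: slide_def)

lemma openin_Open_edge: "openin (top_of_set X) Open_edge"
proof -
  have "Open_edge = {f \<in> X. f u > 0} \<inter> {f \<in> X. f v > 0}" by (auto simp: Open_edge_def)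
  then show ?thesis
    by (auto intro!: openin_Int openin_superlevel continuous_intros)
qed

lemma openin_Near: "openin (top_of_set X) Near"
proof -
  have "Near = {f \<in> X. - (f u + f v) > - 1} \<union> {f \<in> X. f u > 1/2} \<union> {f \<in> X. f v > 1/2}" by (auto simp: Near_def)
  then show ?thesis
    by (auto intro!: openin_Un openin_superlevel continuous_intros)
qed

lemma openin_Conf_near: "openin (top_of_set (Conf Z)) (Conf_near Z)"
proof -
  have "Conf_near Z = {z \<in> Conf Z. - (snd z u + snd z v) > - 1} \<union> {z \<in> Conf Z. 2 * snd z u - fst z u > 1}
      \<union> {z \<in> Conf Z. 2 * snd z v - fst z v > 1}" by (auto simp: Conf_near_def)
  then show ?thesis
    by (auto intro!: openin_Un openin_superlevel continuous_intros)
qed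

lemma openin_Conf_edge: "openin (top_of_set (Conf Z)) (Conf_edge Z)"
proof -
  have "Conf_edge Z = {z \<in> Conf Z. snd z u > 0} \<inter> {z \<in> Conf Z. snd z v > 0}" by (auto simp: Conf_edge_def Conf_def Open_edge_def)
  then show ?thesis
    by (auto intro!: openin_Int openin_superlevel continuous_intros)
qed

text \<open>If the second particle sits at an end of the edge, the first one is elsewhere, so its coordinate at that
  end is less than 1 and the neighbourhood condition holds.\<close>
lemma Conf_cover:
  assumes "Z \<subseteq> X"
  shows "Conf_near Z \<union> Conf_edge Z = Conf Z"
proof -
  have "z \<in> Conf_near Z" if z: "z \<in> Conf Z" "snd z \<notin> Open_edge" for z
  proof (rule ccontr)
    obtain x y where xy: "z = (x, y)" by (cases z)
    assume "z \<notin> Conf_near Z"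
    then have *: "1 \<le> y u + y v" "2 * y u \<le> 1 + x u" "2 * y v \<le> 1 + x v"
      using z xy by (auto simp: Conf_near_def)
    have y: "y \<in> Old" "y \<in> X" "x \<in> X" "x \<noteq> y" using z xy Old_iff_not_Open_edge assms by (auto simp: Conf_def)
    have "y = end_u \<or> y = end_v"
      using y * end_u_iff[of y] end_v_iff[of y] sum_le_1[of y] by (auto simp: Old_def)
    then show False
      using * y end_u_iff[of x] end_v_iff[of x] sum_le_1[of x] nonneg[of x u] nonneg[of x v] by auto
  qed
  then show ?thesis by (auto simp: Conf_near_def Conf_edge_def)
qed

lemma Conf_overlap:
  assumes "Z \<subseteq> X"
  shows "Conf_near Z \<inter> Conf_edge Z = Corner Z \<union> {z \<in> Z \<times> Open_edge. 2 * snd z v > 1 + fst z v}"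
proof (rule Set.set_eqI)
  fix z :: "('v \<Rightarrow> real) \<times> ('v \<Rightarrow> real)"
  obtain x y where z: "z = (x, y)" by (cases z)
  have ne: "x \<noteq> y" if "x \<in> X" "2 * y u > 1 + x u \<or> 2 * y v > 1 + x v"
    using that sum_le_1[of x] nonneg[of x u] nonneg[of x v] by auto
  have sum: "y u + y v = 1" if "y \<in> Open_edge"
    using that edge_disj by (auto simp: Open_edge_def)
  show "z \<in> Conf_near Z \<inter> Conf_edge Z \<longleftrightarrow> z \<in> Corner Z \<union> {z \<in> Z \<times> Open_edge. 2 * snd z v > 1 + fst z v}"
    using sum ne assms part_inclusions unfolding Conf_near_def Conf_edge_def Corner_def Conf_def z by auto
qed

text \<open>While the second particle retreats to an end, its coordinate at that end increases, and it already
  exceeds the one of the first particle.\<close>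
lemma collapse_avoids_first:
  assumes Z: "Z \<subseteq> X" and z: "(x, y) \<in> Conf_near Z" and s: "0 \<le> s" "s \<le> 1"
  shows "(x, segment_point s y (collapse y)) \<in> Conf Z"
proof -
  have xy: "x \<in> Z" "y \<in> X" "x \<noteq> y" "x \<in> X" using z Z by (auto simp: Conf_near_def Conf_def)
  have "x \<noteq> segment_point s y (collapse y)"
  proof (cases "y \<in> Old")
    case True
    then show ?thesis using xy by (simp add: collapse_Old)
  next
    case False
    then have Open_edge: "y u > 0" "y v > 0" "y u + y v = 1"
      using xy Old_iff edge_disj by auto
    then consider "2 * y u > 1 + x u" | "2 * y v > 1 + x v"
      using z by (auto simp: Conf_near_def)
    then show ?thesis
    proof cases
      case 1
      then have "y u > 1/2" using nonneg[of x u] xy by auto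
      then have r: "collapse y = end_u" using False Open_edge by (simp add: collapse_def)
      have "segment_point s y (collapse y) u = y u + s * (1 - y u)"
        unfolding r by (simp add: segment_point_def algebra_simps)
      then have "segment_point s y (collapse y) u \<ge> y u" using Open_edge s by simp
      moreover have "x u < y u" using 1 Open_edge by linarith
      ultimately show ?thesis by auto
    next
      case 2
      then have "y v > 1/2" using nonneg[of x v] xy by auto
      then have r: "collapse y = end_v" using False Open_edge by (simp add: collapse_def)
      have "segment_point s y (collapse y) v = y v + s * (1 - y v)"
        unfolding r by (simp add: segment_point_def algebra_simps)
      then have "segment_point s y (collapse y) v \<ge> y v" using Open_edge s by simp
      moreover have "x v < y v" using 2 Open_edge by linarith
      ultimately show ?thesis by auto
    qed
  qed
  then show ?thesis
    using xy segment_collapse_in_X[OF _ s] by (auto simp: Conf_def)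
qed

lemma Conf_near_second: "Z \<subseteq> X \<Longrightarrow> z \<in> Conf_near Z \<Longrightarrow> snd z \<in> Near"
proof -
  assume Z: "Z \<subseteq> X" and z: "z \<in> Conf_near Z"
  then have "fst z \<in> X" "snd z \<in> X" by (auto simp: Conf_near_def Conf_def)
  then show "snd z \<in> Near"
    using z nonneg[of "fst z" u] nonneg[of "fst z" v] by (auto simp: Conf_near_def Near_def)
qed

lemma Conf_near_homology:
  assumes Z: "Z \<subseteq> X" and a: "a \<in> carrier (H p (Conf_near Z))"
  shows "\<exists>a0 \<in> carrier (H p (Conf_old Z)). Hmap p (Conf_near Z) (Conf Z) id a = Hmap p (Conf_old Z) (Conf Z) id a0"
proof -
  have e: "Conf Z \<inter> Z \<times> Old = Conf_old Z" using part_inclusions by (auto simp: Conf_def Conf_old_def)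
  have "Conf_near Z \<subseteq> Z \<times> Near" using Conf_near_second[OF Z] by (force simp: Conf_near_def Conf_def)
  moreover have "Conf_near Z \<subseteq> Conf Z" "Conf Z \<subseteq> Z \<times> X" by (auto simp: Conf_near_def Conf_def)
  ultimately show ?thesis
    using collar_homology[of "Conf_near Z" Z "Conf Z" a p] collapse_avoids_first[OF Z] a unfolding e by blast
qed

lemma product_collar_homology:
  assumes a: "a \<in> carrier (H p (Z \<times> Near))"
  shows "\<exists>a0 \<in> carrier (H p (Z \<times> Old)). Hmap p (Z \<times> Near) (Z \<times> X) id a = Hmap p (Z \<times> Old) (Z \<times> X) id a0"
proof -
  have e: "Z \<times> X \<inter> Z \<times> Old = Z \<times> Old" using part_inclusions by auto
  show ?thesis
    using collar_homology[of "Z \<times> Near" Z "Z \<times> X" a p] segment_collapse_in_X a part_inclusions unfolding e by blast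
qed

text \<open>Over the open edge the two cases \<open>x u > y u\<close> and \<open>x u < y u\<close> are closed, as the particles never coincide.\<close>
lemma continuous_on_slide:
  assumes Z: "Z = Old \<or> Z = X"
  shows "continuous_on (Conf_edge Z) slide"
proof -
  let ?E = "\<lambda>z. fst z u + fst z v \<ge> 1"
  have BX: "fst z \<in> X" "snd z \<in> Open_edge" "fst z \<noteq> snd z" if "z \<in> Conf_edge Z" for z
    using that Z part_inclusions by (auto simp: Conf_edge_def Conf_def)
  have Gi: "fst z \<in> Old \<longleftrightarrow> - (fst z u * fst z v) \<ge> 0" if "z \<in> Conf_edge Z" for z
  proof -
    have "0 \<le> fst z u" "0 \<le> fst z v" using BX[OF that] nonneg by auto
    then show ?thesis using Old_iff[OF BX(1)[OF that]] mult_nonneg_nonneg[of "fst z u" "fst z v"]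
      by (auto simp: mult_le_0_iff)
  qed
  have E: "continuous_on {z \<in> Conf_edge Z. ?E z} (\<lambda>z. if fst z u \<ge> snd z u then end_u else end_v)"
  proof (rule continuous_on_if_closed_pieces[where Q = "\<lambda>z. snd z u - fst z u \<ge> 0"])
    have "{z \<in> {z \<in> Conf_edge Z. ?E z}. fst z u \<ge> snd z u} = {z \<in> {z \<in> Conf_edge Z. ?E z}. fst z u - snd z u \<ge> 0}" by auto
    then show "closedin (top_of_set {z \<in> Conf_edge Z. ?E z}) {z \<in> {z \<in> Conf_edge Z. ?E z}. fst z u \<ge> snd z u}"
      by (simp only:) (intro closedin_superlevel continuous_intros)
    show "closedin (top_of_set {z \<in> Conf_edge Z. ?E z}) {z \<in> {z \<in> Conf_edge Z. ?E z}. snd z u - fst z u \<ge> 0}"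
      by (intro closedin_superlevel continuous_intros)
    fix z assume z: "z \<in> {z \<in> Conf_edge Z. ?E z}" "fst z u \<ge> snd z u" "snd z u - fst z u \<ge> 0"
    then have "fst z = edge_point (fst z u)" "snd z = edge_point (snd z u)" "fst z u = snd z u"
      using BX[of z] on_edge[of "fst z"] sum_le_1[of "fst z"] Open_edge_eq[of "snd z"] by auto
    then show "end_u = end_v" using BX[of z] z by (metis (mono_tags) mem_Collect_eq)
  qed auto
  have "continuous_on (Conf_edge Z) (\<lambda>z. if fst z \<in> Old then fst z else if fst z u \<ge> snd z u then end_u else end_v)"
  proof (rule continuous_on_if_closed_pieces[where Q = ?E])
    have "{z \<in> Conf_edge Z. fst z \<in> Old} = {z \<in> Conf_edge Z. - (fst z u * fst z v) \<ge> 0}" using Gi by blast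
    then show "closedin (top_of_set (Conf_edge Z)) {z \<in> Conf_edge Z. fst z \<in> Old}"
      by (simp only:) (intro closedin_superlevel continuous_intros)
    show "closedin (top_of_set (Conf_edge Z)) {z \<in> Conf_edge Z. ?E z}"
      by (intro closedin_superlevel continuous_intros)
    show "fst z \<in> Old \<or> ?E z" if "z \<in> Conf_edge Z" for z
      using BX[OF that] Old_iff[of "fst z"] edge_disj[of "fst z"] by auto
    show "fst z = (if snd z u \<le> fst z u then end_u else end_v)" if "z \<in> Conf_edge Z" "fst z \<in> Old" "?E z" for z
    proof -
      have "snd z u < 1" "snd z u > 0" using BX[OF that(1)] edge_disj[of "snd z"] by (auto simp: Open_edge_def)
      moreover have "fst z = end_u \<or> fst z = end_v"
        using BX[OF that(1)] that sum_le_1[of "fst z"] end_u_iff[of "fst z"] end_v_iff[of "fst z"] by (auto simp: Old_def)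
      ultimately show ?thesis by auto
    qed
  qed (use E in \<open>auto intro!: continuous_intros\<close>)
  then show ?thesis
  proof (rule continuous_on_eq)
    fix z assume z: "z \<in> Conf_edge Z"
    have "fst z u \<noteq> snd z u" if "fst z \<notin> Old"
      using Open_edge_eq[of "fst z"] Open_edge_eq[of "snd z"] Old_iff_not_Open_edge[of "fst z"] BX[OF z] that by metis
    then show "(if fst z \<in> Old then fst z else if fst z u \<ge> snd z u then end_u else end_v) = slide z"
      by (cases "fst z \<in> Old") (auto simp: slide_def less_le)
  qed
qed

text \<open>With the second particle inside the edge, the first can be pushed off the edge, away from the second,
  while the second moves to the midpoint.  So \<open>Conf_edge\<close> is homotopy equivalent to the old graph.\<close>
lemma Conf_edge_homology:
  assumes Z: "Z = Old \<or> Z = X" and b: "b \<in> carrier (H p (Conf_edge Z))"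
  shows "b = Hmap p Old (Conf_edge Z) (\<lambda>x. (x, edge_point (1/2))) (Hmap p (Conf_edge Z) Old slide b)"
proof -
  let ?m = "edge_point (1/2)"
  let ?h = "\<lambda>w. (segment_point (fst w) (fst (snd w)) (slide (snd w)), segment_point (fst w) (snd (snd w)) ?m)"
  have qc: "continuous_on (Conf_edge Z) slide" by (rule continuous_on_slide[OF Z])
  have jm: "(\<lambda>x. (x, ?m)) \<in> Old \<rightarrow> Conf_edge Z"
    using Z part_inclusions Old_iff_not_Open_edge by (auto simp: Conf_edge_def Conf_def)
  have "Hmap p (Conf_edge Z) (Conf_edge Z) (\<lambda>z. ?h (0, z)) = Hmap p (Conf_edge Z) (Conf_edge Z) (\<lambda>z. ?h (1, z))"
  proof (rule Hmap_homotopic)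
    show "continuous_on ({0..1} \<times> Conf_edge Z) ?h"
      by (intro continuous_intros continuous_on_compose2[OF qc, of _ snd]) auto
    show "?h \<in> {0..1} \<times> Conf_edge Z \<rightarrow> Conf_edge Z"
    proof
      fix w :: "real \<times> ('v \<Rightarrow> real) \<times> ('v \<Rightarrow> real)" assume w: "w \<in> {0..1} \<times> Conf_edge Z"
      obtain s x y where sxy: "w = (s, x, y)" by (cases w)
      have s: "0 \<le> s" "s \<le> 1" and z: "(x, y) \<in> Conf_edge Z" using w sxy by auto
      have xy: "x \<in> Z" "x \<in> X" "y \<in> Open_edge" "x \<noteq> y" using z Z part_inclusions by (auto simp: Conf_edge_def Conf_def)
      have yu: "0 < y u" "y u < 1" using xy edge_disj[of y] by (auto simp: Open_edge_def)
      define t where "t = (1 - s) * y u + s * (1/2)"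
      have ty: "segment_point s y ?m = edge_point t"
        using segment_edge[OF s Open_edge_eq[OF xy(3)], of ?m] by (simp add: t_def)
      have t: "0 < t" "t < 1"
        using convex_bound_lt[of "y u" 1 "1/2" "1 - s" s] convex_bound_lt[of "- y u" 0 "-1/2" "1 - s" s] yu s
        by (auto simp: t_def)
      have tD: "edge_point t \<in> Open_edge" using t by simp
      show "?h w \<in> Conf_edge Z"
      proof (cases "x \<in> Old")
        case True
        then have "?h w = (x, edge_point t)" using sxy ty by (simp add: slide_def)
        then show ?thesis using True tD xy Old_iff_not_Open_edge[of x] part_inclusions by (auto simp: Conf_edge_def Conf_def)
      next
        case False
        then have ZX: "Z = X" using Z xy by auto
        have xe: "x = edge_point (x u)" using False xy Old_iff_not_Open_edge Open_edge_eq by blast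
        have xu: "0 < x u" "x u < 1" using False xy Old_iff edge_disj[of x] by force+
        have ne: "x u \<noteq> y u" using xe Open_edge_eq[OF xy(3)] xy by metis
        define r where "r = (1 - s) * x u + s * (slide (x, y) u)"
        have "slide (x, y) = end_u \<or> slide (x, y) = end_v" using False by (simp add: slide_def)
        then have qe: "slide (x, y) = edge_point (slide (x, y) u)" using end_u_eq end_v_eq by metis
        have tx: "segment_point s x (slide (x, y)) = edge_point r"
          using segment_edge[OF s xe qe] by (simp add: r_def)
        have "slide (x, y) u \<ge> 0 \<and> slide (x, y) u \<le> 1" using False by (auto simp: slide_def)
        then have "0 \<le> r" "r \<le> 1"
          using s xu convex_bound_le[of "x u" 1 "slide (x, y) u" "1 - s" s] by (auto simp: r_def)
        moreover have "r \<noteq> t"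
        proof (cases "x u > y u")
          case True
          then have "r - t = (1 - s) * (x u - y u) + s * (1/2)" using False by (simp add: slide_def r_def t_def algebra_simps)
          also have "\<dots> > 0" using s True by (cases "s = 0") (auto intro!: add_nonneg_pos)
          finally show ?thesis by simp
        next
          case F: False
          then have "t - r = (1 - s) * (y u - x u) + s * (1/2)" using False by (simp add: slide_def r_def t_def algebra_simps)
          also have "\<dots> > 0" using s F ne by (cases "s = 0") (auto intro!: add_nonneg_pos)
          finally show ?thesis by simp
        qed
        moreover have "r = t" if "edge_point r = edge_point t"
          using arg_cong[OF that, of "\<lambda>f. f u"] by simp
        ultimately have "edge_point r \<in> X" "edge_point r \<noteq> edge_point t"
          by auto
        then show ?thesis
          using sxy tx ty tD part_inclusions ZX by (auto simp: Conf_edge_def Conf_def)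
      qed
    qed
  qed
  moreover have "Hmap p (Conf_edge Z) (Conf_edge Z) (\<lambda>z. ?h (0, z)) b = b"
    using b by (intro Hmap_ident) auto
  moreover have "Hmap p Old (Conf_edge Z) (\<lambda>x. (x, ?m)) (Hmap p (Conf_edge Z) Old slide b) = Hmap p (Conf_edge Z) (Conf_edge Z) (\<lambda>z. ?h (1, z)) b"
    using qc slide_in_Old jm by (subst Hmap_comp) (auto simp: o_def intro!: continuous_intros)
  ultimately show ?thesis by simp
qed

end

lemma path_connected_superset_component:
  assumes "path_connected T" "T \<subseteq> S" "x \<in> T" "y \<in> T"
  shows "path_component S x y"
  using assms by (meson path_component_of_subset path_connected_component)

section \<open>Allowing the second particle onto the edge\<close>

context edge_attachment
begin

lemma openin_Old_minus_end: "openin (top_of_set Old) (Old - {end_u})" "openin (top_of_set Old) (Old - {end_v})"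
proof -
  have "f \<noteq> end_u \<longleftrightarrow> - f u > - 1" "f \<noteq> end_v \<longleftrightarrow> - f v > - 1" if "f \<in> Old" for f
  proof -
    have "f \<in> X" using that part_inclusions by blast
    then show "f \<noteq> end_u \<longleftrightarrow> - f u > - 1" "f \<noteq> end_v \<longleftrightarrow> - f v > - 1"
      using end_u_iff[of f] end_v_iff[of f] sum_le_1[of f] nonneg[of f u] nonneg[of f v] by auto
  qed
  then have "Old - {end_u} = {f \<in> Old. - f u > - 1}" "Old - {end_v} = {f \<in> Old. - f v > - 1}"
    by blast+
  then show "openin (top_of_set Old) (Old - {end_u})" "openin (top_of_set Old) (Old - {end_v})"
    by (simp_all only:) (intro openin_superlevel continuous_intros)+
qed

end

text \<open>The connectivity of the old graph that the argument uses.  The set \<open>P\<close> joins the ends of the new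
  edge and avoids the point \<open>w\<close>, at which the first particle can rest while the second one runs through
  the edge and back along \<open>P\<close>.\<close>
locale connected_edge_attachment = edge_attachment X u v for X :: "('v \<Rightarrow> real) set" and u v +
  fixes P :: "('v \<Rightarrow> real) set" and w :: "'v \<Rightarrow> real"
  assumes pcUV: "path_connected (Old - {end_u, end_v})"
    and pcU: "path_connected (Old - {end_u})" and pcV: "path_connected (Old - {end_v})"
    and P: "path_connected P" "end_u \<in> P" "end_v \<in> P" "P \<subseteq> Old"
    and w: "w \<in> Old" "w \<notin> P"
begin

lemma w_simps [simp]: "w \<in> Old" "w \<noteq> end_u" "w \<noteq> end_v"
  using w P by auto

lemma path_connected_Old: "path_connected Old"
proof -
  have "path_connected ((Old - {end_u}) \<union> (Old - {end_v}))"
    by (rule path_connected_Un[OF pcU pcV]) (use w_simps in blast)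
  also have "(Old - {end_u}) \<union> (Old - {end_v}) = Old"
    using ends_in by auto
  finally show ?thesis .
qed

lemma X_eq_Old_un_edge: "X = Old \<union> edge_point ` {0..1}"
proof -
  have "f \<in> edge_point ` {0..1}" if "f \<in> X" "f \<notin> Old" for f
  proof -
    have "f \<in> Open_edge" using that Old_iff_not_Open_edge by auto
    then have "f = edge_point (f u)" "f u \<in> {0..1}"
      using Open_edge_eq[of f] edge_disj[of f] by (auto simp: Open_edge_def simp del: edge_point_simps)
    then show ?thesis by blast
  qed
  then show ?thesis using part_inclusions by auto
qed

lemma path_connected_edge_part: "convex I \<Longrightarrow> path_connected (edge_point ` (I :: real set))"
  by (intro path_connected_continuous_image continuous_intros convex_imp_path_connected)

lemma edge_point_inj: "edge_point a = edge_point b \<longleftrightarrow> a = b"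
  by (metis edge_point_simps(1))

lemma path_connected_X: "path_connected X"
proof -
  have "end_u \<in> edge_point ` {0..1}" by (auto simp: end_u_def)
  then have "path_connected (Old \<union> edge_point ` {0..1})"
    by (intro path_connected_Un path_connected_Old path_connected_edge_part) (use ends_in in \<open>blast | simp\<close>)+
  then show ?thesis
    by (simp flip: X_eq_Old_un_edge)
qed

lemma path_connected_X_minus: "path_connected (X - {end_u})" "path_connected (X - {end_v})"
proof -
  have "(Old \<union> edge_point ` {0..1}) - {end_u} = (Old - {end_u}) \<union> edge_point ` {0..<1}"
    by (auto simp: end_u_def edge_point_inj less_le)
  then have "X - {end_u} = (Old - {end_u}) \<union> edge_point ` {0..<1}"
    by (simp flip: X_eq_Old_un_edge)
  moreover have "end_v \<in> edge_point ` {0..<1}" by (auto simp: end_v_def)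
  then have "(Old - {end_u}) \<inter> edge_point ` {0..<1} \<noteq> {}" using ends_in by blast
  ultimately show "path_connected (X - {end_u})"
    using path_connected_Un[OF pcU path_connected_edge_part] by simp
  have "(Old \<union> edge_point ` {0..1}) - {end_v} = (Old - {end_v}) \<union> edge_point ` {0<..1}"
    by (auto simp: end_v_def edge_point_inj less_le)
  then have "X - {end_v} = (Old - {end_v}) \<union> edge_point ` {0<..1}"
    by (simp flip: X_eq_Old_un_edge)
  moreover have "end_u \<in> edge_point ` {0<..1}" by (auto simp: end_u_def)
  then have "(Old - {end_v}) \<inter> edge_point ` {0<..1} \<noteq> {}" using ends_in by blast
  ultimately show "path_connected (X - {end_v})"
    using path_connected_Un[OF pcV path_connected_edge_part] by simp
qed

lemma factor_connected:
  assumes "Z = Old \<or> Z = X"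
  shows "path_connected Z" "path_connected (Z - {end_u})" "path_connected (Z - {end_v})"
    "Z \<subseteq> X" "Old \<subseteq> Z"
  using assms pcU pcV path_connected_Old path_connected_X path_connected_X_minus part_inclusions by auto

definition Corner' where "Corner' Z = {z \<in> Z \<times> Open_edge. 2 * snd z v > 1 + fst z v}"

lemma swap_Corner: "edge_attachment.Corner X v u Z = Corner' Z"
proof -
  interpret sw: edge_attachment X v u by (rule swap)
  show ?thesis by (simp add: sw.Corner_def Corner'_def swap_simps)
qed

lemma Corner'_path_connected:
  assumes "Z = Old \<or> Z = X" shows "path_connected (Corner' Z)"
proof -
  interpret sw: edge_attachment X v u by (rule swap)
  show ?thesis
    using sw.Corner_path_connected[of Z] factor_connected[OF assms] by (simp add: swap_Corner swap_simps)
qed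

lemma Corner'_section:
  assumes "Z = Old \<or> Z = X"
  obtains \<sigma> where "continuous_on (Old - {end_v}) \<sigma>" "\<sigma> \<in> Old - {end_v} \<rightarrow> Corner' Z" "\<And>x. fst (\<sigma> x) = x"
proof -
  interpret sw: edge_attachment X v u by (rule swap)
  show ?thesis
    using sw.Corner_section[of Z] factor_connected[OF assms] that unfolding swap_Corner swap_simps by metis
qed

lemma Conf_near_edge_overlap:
  assumes "Z = Old \<or> Z = X" shows "Conf_near Z \<inter> Conf_edge Z = Corner Z \<union> Corner' Z"
  using Conf_overlap factor_connected[OF assms] by (simp add: Corner'_def)

lemma Corners_nonempty:
  assumes Z: "Z = Old \<or> Z = X"
  obtains nu nv where "nu \<in> Corner Z" "nv \<in> Corner' Z"
proof -
  obtain s where "s \<in> Old - {end_u} \<rightarrow> Corner Z" using Corner_section[of Z] factor_connected[OF Z] by metis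
  moreover obtain s' where "s' \<in> Old - {end_v} \<rightarrow> Corner' Z" using Corner'_section[OF Z] by metis
  ultimately have "s w \<in> Corner Z" "s' w \<in> Corner' Z" by auto
  then show thesis using that by blast
qed

lemma Open_edge_sum: "y \<in> Open_edge \<Longrightarrow> y u + y v = 1"
  using edge_disj by (auto simp: Open_edge_def)

text \<open>The two components of the overlap are told apart by the end to which the second particle is close.
  The left inverse sends each half of the edge to a fixed pair in the corresponding corner.\<close>
lemma H0_collars_inj:
  assumes Z: "Z = Old \<or> Z = X"
    and c: "c \<in> carrier (H 0 (Conf_near Z \<inter> Conf_edge Z))" "Hmap 0 (Conf_near Z \<inter> Conf_edge Z) (Near \<inter> Open_edge) snd c = \<one>\<^bsub>H 0 (Near \<inter> Open_edge)\<^esub>"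
  shows "c = \<one>\<^bsub>H 0 (Conf_near Z \<inter> Conf_edge Z)\<^esub>"
proof -
  obtain nu nv where n: "nu \<in> Corner Z" "nv \<in> Corner' Z" using Corners_nonempty[OF Z] .
  let ?h = "\<lambda>y. if y u \<ge> 1/2 then nu else nv"
  have AB: "Conf_near Z \<inter> Conf_edge Z = Corner Z \<union> Corner' Z" by (rule Conf_near_edge_overlap[OF Z])
  have half: "y u > 1/2 \<or> y v > 1/2" if "y \<in> Near \<inter> Open_edge" for y
    using that Open_edge_sum[of y] by (auto simp: Near_def)
  show ?thesis
  proof (rule H0_map_inj_if_left_inverse[where f = snd and h = ?h and T = "Near \<inter> Open_edge"])
    show "continuous_on (Conf_near Z \<inter> Conf_edge Z) snd" by (intro continuous_intros)
    show "snd \<in> Conf_near Z \<inter> Conf_edge Z \<rightarrow> Near \<inter> Open_edge"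
      using Conf_near_second factor_connected[OF Z] by (auto simp: Conf_edge_def)
    show "continuous_on (Near \<inter> Open_edge) ?h"
    proof (rule continuous_on_if_closed_pieces[where Q = "\<lambda>y. y v \<ge> 1/2"])
      show "closedin (top_of_set (Near \<inter> Open_edge)) {y \<in> Near \<inter> Open_edge. 1/2 \<le> y u}"
        "closedin (top_of_set (Near \<inter> Open_edge)) {y \<in> Near \<inter> Open_edge. 1/2 \<le> y v}"
        by (intro closedin_superlevel continuous_intros)+
      show "y u \<ge> 1/2 \<or> y v \<ge> 1/2" if "y \<in> Near \<inter> Open_edge" for y
        using half[OF that] by auto
      show "nu = nv" if "y \<in> Near \<inter> Open_edge" "y u \<ge> 1/2" "y v \<ge> 1/2" for y
        using half[OF that(1)] Open_edge_sum[of y] that by auto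
    qed auto
    show "?h \<in> Near \<inter> Open_edge \<rightarrow> Conf_near Z \<inter> Conf_edge Z"
      unfolding AB using n by simp
    show "path_component (Conf_near Z \<inter> Conf_edge Z) z (?h (snd z))" if z: "z \<in> Conf_near Z \<inter> Conf_edge Z" for z
    proof -
      consider "z \<in> Corner Z" | "z \<in> Corner' Z" using z unfolding AB by blast
      then show ?thesis
      proof cases
        case 1
        then have "fst z u \<ge> 0" using nonneg factor_connected[OF Z] by (auto simp: Corner_def)
        then have "snd z u \<ge> 1/2" using 1 by (auto simp: Corner_def)
        moreover have "path_connected (Corner Z)"
          using Corner_path_connected factor_connected[OF Z] by simp
        ultimately show ?thesis
          using path_connected_superset_component[of "Corner Z" "Conf_near Z \<inter> Conf_edge Z" z nu] 1 n(1) by (simp add: AB)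
      next
        case 2
        then have "fst z v \<ge> 0" using nonneg factor_connected[OF Z] by (auto simp: Corner'_def)
        then have "snd z v > 1/2" using 2 by (auto simp: Corner'_def)
        then have "\<not> snd z u \<ge> 1/2" using Open_edge_sum[of "snd z"] 2 by (auto simp: Corner'_def)
        then show ?thesis
          using path_connected_superset_component[of "Corner' Z" "Conf_near Z \<inter> Conf_edge Z" z nv] 2 n(2)
            Corner'_path_connected[OF Z] by (simp add: AB)
      qed
    qed
  qed (use c in auto)
qed

text \<open>Since \<open>Conf_edge\<close> has the homology of the old graph, a class splits into one that avoids the end \<open>u\<close> and
  one that avoids the end \<open>v\<close>; this uses that the old graph stays connected without both.  A first particle avoiding
  an end leaves room for the second particle near that end.\<close>
lemma H1_collars_surj:
  assumes Z: "Z = Old \<or> Z = X"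
  shows "carrier (H 1 (Conf_edge Z)) \<subseteq> Hmap 1 (Conf_near Z \<inter> Conf_edge Z) (Conf_edge Z) id ` carrier (H 1 (Conf_near Z \<inter> Conf_edge Z))"
proof
  fix b assume b: "b \<in> carrier (H 1 (Conf_edge Z))"
  have AB: "Conf_near Z \<inter> Conf_edge Z = Corner Z \<union> Corner' Z" by (rule Conf_near_edge_overlap[OF Z])
  obtain s where s: "continuous_on (Old - {end_u}) s" "s \<in> Old - {end_u} \<rightarrow> Corner Z" "\<And>x. fst (s x) = x"
    using Corner_section[of Z] factor_connected[OF Z] by metis
  obtain s' where s': "continuous_on (Old - {end_v}) s'" "s' \<in> Old - {end_v} \<rightarrow> Corner' Z" "\<And>x. fst (s' x) = x"
    using Corner'_section[OF Z] by metis
  have qc: "continuous_on (Conf_edge Z) slide" by (rule continuous_on_slide[OF Z])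
  have sub: "(Old - {end_u}) \<union> (Old - {end_v}) = Old" "(Old - {end_u}) \<inter> (Old - {end_v}) = Old - {end_u, end_v}"
    "(Old - {end_v}) \<union> (Old - {end_u, end_v}) = Old - {end_v}"
    using ends_in by auto
  obtain a a' where a: "a \<in> carrier (H 1 (Old - {end_u}))" "a' \<in> carrier (H 1 (Old - {end_v}))"
    "Hmap 1 (Conf_edge Z) Old slide b = Hmap 1 (Old - {end_u}) Old id a \<otimes>\<^bsub>H 1 Old\<^esub> Hmap 1 (Old - {end_v}) Old id a'"
    using H1_sum_of_open_cover[OF openin_Old_minus_end sub(1), of "Old - {end_u, end_v}" "Hmap 1 (Conf_edge Z) Old slide b"]
    unfolding sub using pcUV Hmap_carrier by blast
  let ?AB = "Conf_near Z \<inter> Conf_edge Z"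
  define d where "d = Hmap 1 (Old - {end_u}) ?AB s a \<otimes>\<^bsub>H 1 ?AB\<^esub> Hmap 1 (Old - {end_v}) ?AB s' a'"
  interpret AB: group "H 1 ?AB" by simp
  have dc: "d \<in> carrier (H 1 ?AB)" unfolding d_def by (intro AB.m_closed Hmap_carrier)
  have sAB: "s \<in> Old - {end_u} \<rightarrow> ?AB" "s' \<in> Old - {end_v} \<rightarrow> ?AB"
    unfolding AB using s(2) s'(2) by blast+
  have qAB: "continuous_on ?AB slide" "slide \<in> ?AB \<rightarrow> Old"
    using continuous_on_subset[OF qc, of ?AB] slide_in_Old by auto
  have "Hmap 1 (Old - {end_u}) Old (slide \<circ> s) = Hmap 1 (Old - {end_u}) Old id"
    "Hmap 1 (Old - {end_v}) Old (slide \<circ> s') = Hmap 1 (Old - {end_v}) Old id"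
    by (intro Hmap_cong; use s(3) s'(3) in \<open>simp add: slide_def\<close>)+
  moreover have "Hmap 1 ?AB Old slide (Hmap 1 (Old - {end_u}) ?AB s a) = Hmap 1 (Old - {end_u}) Old (slide \<circ> s) a"
    "Hmap 1 ?AB Old slide (Hmap 1 (Old - {end_v}) ?AB s' a') = Hmap 1 (Old - {end_v}) Old (slide \<circ> s') a'"
    by (rule Hmap_comp[OF s(1) sAB(1) qAB] Hmap_comp[OF s'(1) sAB(2) qAB])+
  ultimately have "Hmap 1 ?AB Old slide d = Hmap 1 (Conf_edge Z) Old slide b"
    unfolding d_def a(3) by (simp add: Hmap_mult Hmap_carrier)
  moreover have "Hmap 1 ?AB Old slide d = Hmap 1 (Conf_edge Z) Old slide (Hmap 1 ?AB (Conf_edge Z) id d)"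
    using qc slide_in_Old by (subst Hmap_comp) auto
  ultimately have "Hmap 1 (Conf_edge Z) Old slide (Hmap 1 ?AB (Conf_edge Z) id d) = Hmap 1 (Conf_edge Z) Old slide b" by simp
  then have "Hmap 1 ?AB (Conf_edge Z) id d = b"
    using Conf_edge_homology[OF Z b] Conf_edge_homology[OF Z Hmap_carrier] by metis
  then show "b \<in> Hmap 1 ?AB (Conf_edge Z) id ` carrier (H 1 ?AB)"
    using dc by blast
qed

text \<open>A class whose second particle runs homologically trivially does not cross the edge algebraically, so
  it is carried by \<open>Conf_near\<close>, from which the second particle retreats to the old graph.\<close>
lemma configuration_class_from_Old:
  assumes Z: "Z = Old \<or> Z = X"
    and x: "x \<in> carrier (H 1 (Conf Z))" "Hmap 1 (Conf Z) X snd x = \<one>\<^bsub>H 1 X\<^esub>"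
  shows "\<exists>a \<in> carrier (H 1 (Conf_old Z)). x = Hmap 1 (Conf_old Z) (Conf Z) id a"
proof -
  note ZX = factor_connected(4)[OF Z]
  obtain a where "a \<in> carrier (H 1 (Conf_near Z))" "x = Hmap 1 (Conf_near Z) (Conf Z) id a"
  proof (rule H1_class_from_open_part[OF openin_Conf_near openin_Conf_edge Conf_cover[OF ZX] openin_Near openin_Open_edge part_inclusions(3), where p = snd])
    show "snd \<in> Conf_near Z \<rightarrow> Near" "snd \<in> Conf_edge Z \<rightarrow> Open_edge"
      using Conf_near_second[OF ZX] by (auto simp: Conf_edge_def)
  qed (use x H0_collars_inj[OF Z] H1_collars_surj[OF Z] in \<open>auto intro!: continuous_intros\<close>)
  then show ?thesis using Conf_near_homology[OF ZX] by metis
qed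

text \<open>The same argument without the diagonal removed: over the open edge, moving the second particle to a
  fixed point near an end replaces the corners.\<close>
lemma product_class_from_Near:
  assumes Z: "Z = Old \<or> Z = X"
    and x: "x \<in> carrier (H 1 (Z \<times> X))" "Hmap 1 (Z \<times> X) X snd x = \<one>\<^bsub>H 1 X\<^esub>"
  shows "\<exists>a \<in> carrier (H 1 (Z \<times> Near)). x = Hmap 1 (Z \<times> Near) (Z \<times> X) id a"
proof -
  note fc = factor_connected[OF Z]
  have UZ: "end_u \<in> Z" using fc by auto
  have op: "openin (top_of_set (Z \<times> X)) (Z \<times> Near)" "openin (top_of_set (Z \<times> X)) (Z \<times> Open_edge)"
    "Z \<times> Near \<union> Z \<times> Open_edge = Z \<times> X"
    using openin_Near openin_Open_edge part_inclusions(3) by (auto intro!: openin_Times)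
  have CD: "Z \<times> Near \<inter> Z \<times> Open_edge = Z \<times> (Near \<inter> Open_edge)" by auto
  obtain a where "a \<in> carrier (H 1 (Z \<times> Near))" "x = Hmap 1 (Z \<times> Near) (Z \<times> X) id a"
  proof (rule H1_class_from_open_part[OF op openin_Near openin_Open_edge part_inclusions(3), where p = snd])
    fix c assume c: "c \<in> carrier (H 0 (Z \<times> Near \<inter> Z \<times> Open_edge))" "Hmap 0 (Z \<times> Near \<inter> Z \<times> Open_edge) (Near \<inter> Open_edge) snd c = \<one>\<^bsub>H 0 (Near \<inter> Open_edge)\<^esub>"
    show "c = \<one>\<^bsub>H 0 (Z \<times> Near \<inter> Z \<times> Open_edge)\<^esub>"
    proof (rule H0_map_inj_if_left_inverse[where f = snd and T = "Near \<inter> Open_edge" and h = "\<lambda>y. (end_u, y)"])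
      fix z assume z: "z \<in> Z \<times> Near \<inter> Z \<times> Open_edge"
      have "path_connected (Z \<times> {snd z})"
        using fc by (intro path_connected_Times) auto
      then show "path_component (Z \<times> Near \<inter> Z \<times> Open_edge) z (end_u, snd z)"
        by (rule path_connected_superset_component) (use z UZ in auto)
    qed (use c UZ in \<open>auto intro!: continuous_intros\<close>)
  next
    show "carrier (H 1 (Z \<times> Open_edge)) \<subseteq> Hmap 1 (Z \<times> Near \<inter> Z \<times> Open_edge) (Z \<times> Open_edge) id ` carrier (H 1 (Z \<times> Near \<inter> Z \<times> Open_edge))"
    proof
      fix b assume b: "b \<in> carrier (H 1 (Z \<times> Open_edge))"
      \<comment> \<open>Any point inside the edge other than the midpoint would do.\<close>
      let ?m = "edge_point (3/4)"
      have m: "?m \<in> Near" "?m \<in> Open_edge" by (auto simp: Near_def)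
      let ?h = "\<lambda>w::real \<times> _. (fst (snd w), segment_point (fst w) (snd (snd w)) ?m)"
      have "Hmap 1 (Z \<times> Open_edge) (Z \<times> Open_edge) (\<lambda>z. ?h (0, z)) = Hmap 1 (Z \<times> Open_edge) (Z \<times> Open_edge) (\<lambda>z. ?h (1, z))"
      proof (rule Hmap_homotopic)
        show "continuous_on ({0..1} \<times> Z \<times> Open_edge) ?h" by (intro continuous_intros)
        have "segment_point s y ?m \<in> Open_edge" if "0 \<le> s" "s \<le> 1" "y \<in> Open_edge" for s y
        proof -
          have y: "0 < y u" "y u < 1" using that edge_disj[of y] by (auto simp: Open_edge_def)
          then have "0 < (1 - s) * y u + s * (3/4)" "(1 - s) * y u + s * (3/4) < 1"
            using convex_bound_lt[of "y u" 1 "3/4" "1 - s" s] convex_bound_lt[of "- y u" 0 "-3/4" "1 - s" s] that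
            by auto
          then show ?thesis
            using segment_edge[OF that(1,2) Open_edge_eq[OF that(3)], of ?m] by simp
        qed
        then show "?h \<in> {0..1} \<times> Z \<times> Open_edge \<rightarrow> Z \<times> Open_edge" by auto
      qed
      moreover have "Hmap 1 (Z \<times> Open_edge) (Z \<times> Open_edge) (\<lambda>z. ?h (0, z)) b = b"
        using b by (intro Hmap_ident) auto
      moreover have "Hmap 1 (Z \<times> Open_edge) (Z \<times> Open_edge) (\<lambda>z. ?h (1, z)) b
        = Hmap 1 (Z \<times> Near \<inter> Z \<times> Open_edge) (Z \<times> Open_edge) id (Hmap 1 (Z \<times> Open_edge) (Z \<times> Near \<inter> Z \<times> Open_edge) (\<lambda>z. (fst z, ?m)) b)"
        using m by (subst Hmap_comp) (auto simp: o_def intro!: continuous_intros)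
      ultimately have "b = Hmap 1 (Z \<times> Near \<inter> Z \<times> Open_edge) (Z \<times> Open_edge) id (Hmap 1 (Z \<times> Open_edge) (Z \<times> Near \<inter> Z \<times> Open_edge) (\<lambda>z. (fst z, ?m)) b)"
        by simp
      then show "b \<in> Hmap 1 (Z \<times> Near \<inter> Z \<times> Open_edge) (Z \<times> Open_edge) id ` carrier (H 1 (Z \<times> Near \<inter> Z \<times> Open_edge))"
        using Hmap_carrier by blast
    qed
  qed (use x in \<open>auto intro!: continuous_intros\<close>)
  then show ?thesis by blast
qed

text \<open>\<open>P\<close>, extended by the two half-edges, connects both components of the overlap of \<open>Near\<close> and \<open>Open_edge\<close>.\<close>
lemma H1_X_sum:
  assumes y: "y \<in> carrier (H 1 X)"
  obtains y1 y2 where "y1 \<in> carrier (H 1 Near)" "y2 \<in> carrier (H 1 (X - {w}))"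
    "y = Hmap 1 Near X id y1 \<otimes>\<^bsub>H 1 X\<^esub> Hmap 1 (X - {w}) X id y2"
proof -
  let ?Q = "edge_point ` {1/2<..1} \<union> P \<union> edge_point ` {0..<1/2}"
  have Q: "path_connected ?Q"
  proof (intro path_connected_Un path_connected_edge_part)
    have "end_u \<in> edge_point ` {1/2<..1}" by (auto simp: end_u_def)
    then show "edge_point ` {1/2<..1} \<inter> P \<noteq> {}" using P by blast
    have "end_v \<in> edge_point ` {0..<1/2}" by (auto simp: end_v_def)
    then show "(edge_point ` {1/2<..1} \<union> P) \<inter> edge_point ` {0..<1/2} \<noteq> {}" using P by blast
  qed (use P in auto)
  have CD: "Near \<inter> Open_edge \<subseteq> ?Q"
  proof
    fix f assume f: "f \<in> Near \<inter> Open_edge"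
    then have "f = edge_point (f u)" "f u > 1/2 \<or> f u < 1/2" "0 < f u" "f u < 1"
      using Open_edge_eq[of f] Open_edge_sum[of f] by (auto simp: Near_def Open_edge_def simp del: edge_point_simps)
    then show "f \<in> ?Q" by (auto simp del: edge_point_simps)
  qed
  have QC: "?Q \<subseteq> Near" using P part_inclusions by (auto simp: Near_def)
  have wQ: "w \<notin> Open_edge \<union> ?Q"
  proof
    assume "w \<in> Open_edge \<union> ?Q"
    moreover have "w \<notin> Open_edge" using w(1) part_inclusions by blast
    moreover have "a = 0 \<or> a = 1" if "w = edge_point a" for a
      using w_simps(1) unfolding that Old_def by auto
    ultimately show False using w w_simps by (auto simp: end_u_def end_v_def)
  qed
  have sub: "Open_edge \<union> ?Q \<subseteq> X - {w}" using wQ QC part_inclusions by blast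
  obtain a b where ab: "a \<in> carrier (H 1 Near)" "b \<in> carrier (H 1 (Open_edge \<union> ?Q))"
    "y = Hmap 1 Near X id a \<otimes>\<^bsub>H 1 X\<^esub> Hmap 1 (Open_edge \<union> ?Q) X id b"
    using H1_sum_of_open_cover[OF openin_Near openin_Open_edge part_inclusions(3) CD QC Q y] .
  have "Hmap 1 (Open_edge \<union> ?Q) X id b = Hmap 1 (X - {w}) X id (Hmap 1 (Open_edge \<union> ?Q) (X - {w}) id b)"
    using sub by (subst Hmap_comp) auto
  then show thesis using that[OF ab(1) Hmap_carrier] ab(3) by metis
qed

text \<open>The new edge is sent to a path in the old graph between its ends.\<close>
lemma retraction_onto_Old:
  obtains r where "continuous_on X r" "r \<in> X \<rightarrow> Old" "\<And>x. x \<in> Old \<Longrightarrow> r x = x"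
proof -
  obtain g where g: "path g" "path_image g \<subseteq> Old" "pathstart g = end_u" "pathfinish g = end_v"
    using path_connected_Old ends_in unfolding path_connected_def by metis
  let ?r = "\<lambda>f. if f u = 0 \<or> f v = 0 then f else g (f v)"
  have v01: "f v \<in> {0..1}" if "f \<in> X" for f
    using nonneg[OF that, of u] nonneg[OF that, of v] sum_le_1[OF that] by auto
  have cg: "continuous_on {f \<in> X. f u + f v \<ge> 1} (\<lambda>f. g (f v))"
  proof (rule continuous_on_compose2[of "{0..1}" g])
    show "continuous_on {0..1} g" using g(1) by (simp add: path_def)
    show "(\<lambda>f. f v) ` {f \<in> X. f u + f v \<ge> 1} \<subseteq> {0..1}" using v01 by auto
  qed (rule continuous_on_coordinate)
  have 1: "{f \<in> X. f u = 0 \<or> f v = 0} = {f \<in> X. - (f u * f v) \<ge> 0}"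
  proof -
    have "f u = 0 \<or> f v = 0 \<longleftrightarrow> - (f u * f v) \<ge> 0" if "f \<in> X" for f
      using mult_nonneg_nonneg[OF nonneg[OF that] nonneg[OF that], of u v] by (auto simp: antisym)
    then show ?thesis by blast
  qed
  have "continuous_on X ?r"
  proof (rule continuous_on_if_closed_pieces[where Q = "\<lambda>f. f u + f v \<ge> 1"])
    show "closedin (top_of_set X) {f \<in> X. f u = 0 \<or> f v = 0}"
      unfolding 1 by (intro closedin_superlevel continuous_intros)
    show "closedin (top_of_set X) {f \<in> X. f u + f v \<ge> 1}"
      by (intro closedin_superlevel continuous_intros)
    show "(f u = 0 \<or> f v = 0) \<or> f u + f v \<ge> 1" if "f \<in> X" for f
      using edge_disj[OF that] nonneg[OF that, of u] nonneg[OF that, of v] by force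
    show "f = g (f v)" if "f \<in> X" "f u = 0 \<or> f v = 0" "f u + f v \<ge> 1" for f
    proof -
      have "f = end_u \<and> f v = 0 \<or> f = end_v \<and> f v = 1"
        using that end_u_iff[of f] end_v_iff[of f] sum_le_1[of f] by auto
      then show ?thesis using g(3,4) by (auto simp: pathstart_def pathfinish_def)
    qed
  qed (use cg in \<open>auto intro!: continuous_intros\<close>)
  moreover have "?r f \<in> Old" if "f \<in> X" for f
  proof (cases "f u = 0 \<or> f v = 0")
    case True
    then show ?thesis using that by (auto simp: Old_def)
  next
    case False
    then show ?thesis using g(2) v01[OF that] by (auto simp: path_image_def)
  qed
  ultimately show thesis
    by (intro that[of ?r]) (auto simp: Old_def)
qed

text \<open>Injectivity pushes a class that dies in the product back over the old graph, where the retraction makes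
  it die already in \<open>Z \<times> Old\<close>.  For surjectivity, the second projection of a given class is corrected by a
  class \<open>c\<close> near the old graph and a class \<open>s\<close> with the first particle resting at \<open>w\<close>; the difference
  comes from \<open>Near\<close> by \<open>product_class_from_Near\<close>.\<close>
theorem second_factor_step:
  assumes Z: "Z = Old \<or> Z = X"
    and iso: "Hmap 1 (Conf_old Z) (Z \<times> Old) id \<in> iso (H 1 (Conf_old Z)) (H 1 (Z \<times> Old))"
  shows "Hmap 1 (Conf Z) (Z \<times> X) id \<in> iso (H 1 (Conf Z)) (H 1 (Z \<times> X))"
proof -
  note fc = factor_connected[OF Z]
  have sub: "Conf_old Z \<subseteq> Conf Z" "Conf_old Z \<subseteq> Z \<times> Old" "Conf Z \<subseteq> Z \<times> X" "Z \<times> Old \<subseteq> Z \<times> X"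
    using part_inclusions by (auto simp: Conf_def Conf_old_def)
  interpret HS: group "H 1 (Conf Z)" by simp
  interpret HX: group "H 1 X" by simp
  interpret HP: comm_group "H 1 (Z \<times> X)" by simp
  interpret al: group_hom "H 1 (Conf Z)" "H 1 (Z \<times> X)" "Hmap 1 (Conf Z) (Z \<times> X) id"
    by (simp add: group_hom_def group_hom_axioms_def hom_induced_hom)
  have square: "Hmap 1 (Conf Z) (Z \<times> X) id (Hmap 1 (Conf_old Z) (Conf Z) id a)
      = Hmap 1 (Z \<times> Old) (Z \<times> X) id (Hmap 1 (Conf_old Z) (Z \<times> Old) id a)" for a
    using sub by (subst (1 2) Hmap_comp) auto
  have inj0: "a = \<one>\<^bsub>H 1 (Conf_old Z)\<^esub>" if "a \<in> carrier (H 1 (Conf_old Z))"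
    "Hmap 1 (Conf_old Z) (Z \<times> Old) id a = \<one>\<^bsub>H 1 (Z \<times> Old)\<^esub>" for a
  proof -
    have "inj_on (Hmap 1 (Conf_old Z) (Z \<times> Old) id) (carrier (H 1 (Conf_old Z)))"
      using iso by (simp add: iso_def bij_betw_def)
    then show ?thesis
      by (rule inj_onD) (use that in \<open>simp_all add: hom_induced_one group.is_monoid\<close>)
  qed
  have inj: "x = \<one>\<^bsub>H 1 (Conf Z)\<^esub>" if x: "x \<in> carrier (H 1 (Conf Z))"
    "Hmap 1 (Conf Z) (Z \<times> X) id x = \<one>\<^bsub>H 1 (Z \<times> X)\<^esub>" for x
  proof -
    have "Hmap 1 (Conf Z) X snd x = Hmap 1 (Z \<times> X) X snd (Hmap 1 (Conf Z) (Z \<times> X) id x)"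
      using sub by (subst Hmap_comp) (auto intro!: continuous_intros)
    then have "Hmap 1 (Conf Z) X snd x = \<one>\<^bsub>H 1 X\<^esub>"
      using x by (simp add: hom_induced_one)
    then obtain a where a: "a \<in> carrier (H 1 (Conf_old Z))" "x = Hmap 1 (Conf_old Z) (Conf Z) id a"
      using configuration_class_from_Old[OF Z] x by blast
    obtain r where r: "continuous_on X r" "r \<in> X \<rightarrow> Old" "\<And>x. x \<in> Old \<Longrightarrow> r x = x"
      by (rule retraction_onto_Old) blast
    let ?a = "Hmap 1 (Conf_old Z) (Z \<times> Old) id a" and ?r = "\<lambda>z. (fst z, r (snd z))"
    have cr: "continuous_on (Z \<times> X) ?r"
      by (intro continuous_intros continuous_on_compose2[OF r(1)]) auto
    have "?a = Hmap 1 (Z \<times> Old) (Z \<times> Old) (?r \<circ> id) ?a"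
      using r(3) by (intro Hmap_ident[symmetric] Hmap_carrier) auto
    also have "\<dots> = Hmap 1 (Z \<times> X) (Z \<times> Old) ?r (Hmap 1 (Z \<times> Old) (Z \<times> X) id ?a)"
      using cr r(2) sub by (subst Hmap_comp) auto
    also have "Hmap 1 (Z \<times> Old) (Z \<times> X) id ?a = \<one>\<^bsub>H 1 (Z \<times> X)\<^esub>"
      using square[of a] x a by simp
    finally have "?a = \<one>\<^bsub>H 1 (Z \<times> Old)\<^esub>"
      by (simp only: hom_induced_one)
    then have "a = \<one>\<^bsub>H 1 (Conf_old Z)\<^esub>" using inj0 a by blast
    then show ?thesis unfolding a(2) by (simp only: hom_induced_one)
  qed
  let ?I = "Hmap 1 (Conf Z) (Z \<times> X) id ` carrier (H 1 (Conf Z))"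
  have C_im: "Hmap 1 (Z \<times> Near) (Z \<times> X) id c \<in> ?I" if c: "c \<in> carrier (H 1 (Z \<times> Near))" for c
  proof -
    obtain c0 where c0: "c0 \<in> carrier (H 1 (Z \<times> Old))"
      "Hmap 1 (Z \<times> Near) (Z \<times> X) id c = Hmap 1 (Z \<times> Old) (Z \<times> X) id c0"
      using product_collar_homology[OF c] by blast
    have "c0 \<in> Hmap 1 (Conf_old Z) (Z \<times> Old) id ` carrier (H 1 (Conf_old Z))"
      using iso c0 by (simp add: iso_def bij_betw_def)
    then obtain a where a: "a \<in> carrier (H 1 (Conf_old Z))" "c0 = Hmap 1 (Conf_old Z) (Z \<times> Old) id a" by blast
    have "Hmap 1 (Z \<times> Near) (Z \<times> X) id c = Hmap 1 (Conf Z) (Z \<times> X) id (Hmap 1 (Conf_old Z) (Conf Z) id a)"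
      unfolding c0 a square ..
    then show ?thesis using Hmap_carrier by blast
  qed
  have mult_I: "x \<otimes>\<^bsub>H 1 (Z \<times> X)\<^esub> y \<in> ?I" if "x \<in> ?I" "y \<in> ?I" for x y
    using that by (auto simp flip: al.hom_mult)
  have "z \<in> ?I" if z: "z \<in> carrier (H 1 (Z \<times> X))" for z
  proof -
    obtain y1 y2 where y: "y1 \<in> carrier (H 1 Near)" "y2 \<in> carrier (H 1 (X - {w}))"
      "Hmap 1 (Z \<times> X) X snd z = Hmap 1 Near X id y1 \<otimes>\<^bsub>H 1 X\<^esub> Hmap 1 (X - {w}) X id y2"
      using H1_X_sum[OF Hmap_carrier] .
    have wZ: "w \<in> Z" using fc by auto
    define c where "c = Hmap 1 Near (Z \<times> Near) (Pair w) y1"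
    define s where "s = Hmap 1 (X - {w}) (Conf Z) (Pair w) y2"
    have c: "c \<in> carrier (H 1 (Z \<times> Near))" and s: "s \<in> carrier (H 1 (Conf Z))"
      unfolding c_def s_def by (rule Hmap_carrier)+
    let ?t = "Hmap 1 (Z \<times> Near) (Z \<times> X) id c \<otimes>\<^bsub>H 1 (Z \<times> X)\<^esub> Hmap 1 (Conf Z) (Z \<times> X) id s"
    have tI: "?t \<in> ?I" using C_im[OF c] s by (intro mult_I) auto
    then have tc: "?t \<in> carrier (H 1 (Z \<times> X))" using Hmap_carrier by blast
    have "Hmap 1 (Z \<times> X) X snd (Hmap 1 (Z \<times> Near) (Z \<times> X) id c) = Hmap 1 (Z \<times> Near) X (snd \<circ> id) c"
      using part_inclusions sub by (intro Hmap_comp continuous_intros) auto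
    also have "\<dots> = Hmap 1 Near X ((snd \<circ> id) \<circ> Pair w) y1"
      unfolding c_def using wZ part_inclusions
      by (intro Hmap_comp) (auto simp: Conf_def intro!: continuous_intros)
    also have "\<dots> = Hmap 1 Near X id y1"
      by (rule fun_cong[OF Hmap_cong]) simp
    finally have sc: "Hmap 1 (Z \<times> X) X snd (Hmap 1 (Z \<times> Near) (Z \<times> X) id c) = Hmap 1 Near X id y1" .
    have "Hmap 1 (Z \<times> X) X snd (Hmap 1 (Conf Z) (Z \<times> X) id s) = Hmap 1 (Conf Z) X (snd \<circ> id) s"
      using part_inclusions sub by (intro Hmap_comp continuous_intros) auto
    also have "\<dots> = Hmap 1 (X - {w}) X ((snd \<circ> id) \<circ> Pair w) y2"
      unfolding s_def using wZ part_inclusions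
      by (intro Hmap_comp) (auto simp: Conf_def intro!: continuous_intros)
    also have "\<dots> = Hmap 1 (X - {w}) X id y2"
      by (rule fun_cong[OF Hmap_cong]) simp
    finally have ss: "Hmap 1 (Z \<times> X) X snd (Hmap 1 (Conf Z) (Z \<times> X) id s) = Hmap 1 (X - {w}) X id y2" .
    have pt: "Hmap 1 (Z \<times> X) X snd ?t = Hmap 1 (Z \<times> X) X snd z"
      unfolding y(3) by (simp only: Hmap_mult Hmap_carrier sc ss)
    let ?z = "z \<otimes>\<^bsub>H 1 (Z \<times> X)\<^esub> inv\<^bsub>H 1 (Z \<times> X)\<^esub> ?t"
    have zc: "?z \<in> carrier (H 1 (Z \<times> X))" by (rule HP.m_closed[OF z HP.inv_closed[OF tc]])
    have "Hmap 1 (Z \<times> X) X snd ?z = Hmap 1 (Z \<times> X) X snd z \<otimes>\<^bsub>H 1 X\<^esub> inv\<^bsub>H 1 X\<^esub> Hmap 1 (Z \<times> X) X snd z"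
      by (simp only: Hmap_mult[OF z HP.inv_closed[OF tc]] Hmap_inv[OF tc] pt)
    also have "\<dots> = \<one>\<^bsub>H 1 X\<^esub>" by (simp add: HX.r_inv Hmap_carrier)
    finally have "?z \<in> ?I"
      using product_class_from_Near[OF Z zc] C_im by metis
    then have "?z \<otimes>\<^bsub>H 1 (Z \<times> X)\<^esub> ?t \<in> ?I" using tI by (rule mult_I)
    moreover have "?z \<otimes>\<^bsub>H 1 (Z \<times> X)\<^esub> ?t = z"
      by (simp only: HP.m_assoc[OF z HP.inv_closed[OF tc] tc] HP.l_inv[OF tc] HP.r_one[OF z])
    ultimately show ?thesis by simp
  qed
  then have surj: "carrier (H 1 (Z \<times> X)) \<subseteq> ?I" by blast
  show ?thesis
    using inj surj by (subst al.iso_iff) auto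
qed

end

section \<open>Realizations of graphs\<close>

definition support :: "('v \<Rightarrow> real) \<Rightarrow> 'v set" where
  "support f = {x. f x \<noteq> 0}"

definition realization_set :: "'v set set \<Rightarrow> ('v \<Rightarrow> real) set" where
  "realization_set K = {f. (\<forall>x. 0 \<le> f x) \<and> support f \<in> K \<and> (\<Sum>x\<in>support f. f x) = 1}"

lemma realization_eq: "realization K = top_of_set (realization_set K)"
  by (simp add: realization_def realization_set_def support_def)

lemma graph_simplex:
  assumes "graph K" "s \<in> K"
  shows "finite s" "s \<noteq> {}" "card s \<le> 2" "\<And>t. t \<noteq> {} \<Longrightarrow> t \<subseteq> s \<Longrightarrow> t \<in> K"
  using assms unfolding graph_def abstract_simplicial_complex_def by blast+

lemma graph_add_edge:
  assumes "graph K" "{u} \<in> K" "{v} \<in> K" "u \<noteq> v"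
  shows "graph (add_edge u v K)"
proof -
  have "t \<in> add_edge u v K" if "s \<in> add_edge u v K" "t \<noteq> {}" "t \<subseteq> s" for s t
  proof (cases "s = {u, v}")
    case True
    then have "t = {u} \<or> t = {v} \<or> t = {u, v}" using that by auto
    then show ?thesis using assms by (auto simp: add_edge_def)
  next
    case False
    then show ?thesis using graph_simplex[OF assms(1), of s] that by (auto simp: add_edge_def)
  qed
  moreover have "finite s \<and> s \<noteq> {} \<and> card s \<le> 2" if "s \<in> add_edge u v K" for s
    using graph_simplex(1-3)[OF assms(1), of s] that assms(4) by (cases "s = {u, v}") (auto simp: add_edge_def)
  moreover have "finite (add_edge u v K)" "{u, v} \<in> add_edge u v K" "card {u, v} = 2"
    using assms by (auto simp: graph_def add_edge_def)
  ultimately show ?thesis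
    unfolding graph_def abstract_simplicial_complex_def by blast
qed

lemma realization_set_sum:
  assumes "graph K" "f \<in> realization_set K" "finite T"
  shows "sum f T \<le> 1" "support f \<subseteq> T \<Longrightarrow> sum f T = 1"
proof -
  have f: "finite (support f)" "\<And>x. 0 \<le> f x" "sum f (support f) = 1"
    using assms graph_simplex[OF assms(1), of "support f"] by (auto simp: realization_set_def)
  have "sum f T = sum f (T \<inter> support f)"
    using assms by (intro sum.mono_neutral_right) (auto simp: support_def)
  also have "\<dots> \<le> sum f (support f)"
    using f by (intro sum_mono2) auto
  finally show "sum f T \<le> 1" using f by simp
  show "sum f T = 1" if "support f \<subseteq> T"
    using f(3) sum.mono_neutral_left[OF assms(3) that, of f] by (auto simp: support_def)
qed

lemma realization_setI:
  assumes "graph K" "\<And>x. 0 \<le> f x" "support f \<subseteq> s" "s \<in> K" "sum f s = 1"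
  shows "f \<in> realization_set K"
proof -
  have "support f \<noteq> {}"
  proof
    assume "support f = {}"
    then have "sum f s = 0" by (auto simp: support_def)
    then show False using assms by simp
  qed
  then have "support f \<in> K" using graph_simplex(4)[OF assms(1,4)] assms(3) by blast
  moreover have "sum f (support f) = sum f s"
    using graph_simplex(1)[OF assms(1,4)] assms(3) by (intro sum.mono_neutral_left) (auto simp: support_def)
  ultimately show ?thesis using assms by (simp add: realization_set_def)
qed

lemma edge_point_realization:
  assumes "graph K" "{x, y} \<in> K" "x \<noteq> y" "0 \<le> a" "a \<le> 1"
  shows "(\<lambda>i. if i = x then a else if i = y then 1 - a else 0) \<in> realization_set K"
  by (rule realization_setI[OF assms(1) _ _ assms(2)]) (use assms in \<open>auto simp: support_def\<close>)

lemma edge_attachment_realization: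
  assumes "graph K" "{u, v} \<in> K" "u \<noteq> v"
  shows "edge_attachment (realization_set K) u v"
proof
  show "u \<noteq> v" by fact
  show "(\<lambda>i. if i = u then a else if i = v then 1 - a else 0) \<in> realization_set K" if "0 \<le> a" "a \<le> 1" for a
    by (rule edge_point_realization[OF assms that])
  fix f assume f: "f \<in> realization_set K"
  show "0 \<le> f i" for i using f by (simp add: realization_set_def)
  show "f u + f v \<le> 1" using realization_set_sum(1)[OF assms(1) f, of "{u, v}"] assms by simp
  show "f u + f v = 1" if "f u > 0" "f v > 0"
  proof -
    have "support f \<in> K" using f by (simp add: realization_set_def)
    then have "finite (support f)" "card (support f) \<le> 2"
      using graph_simplex(1,3)[OF assms(1)] by blast+
    moreover have "{u, v} \<subseteq> support f" using that by (auto simp: support_def)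
    moreover have "card {u, v} = 2" using assms by simp
    ultimately have "{u, v} = support f" by (intro card_seteq) auto
    then have "support f \<subseteq> {u, v}" by simp
    then have "sum f {u, v} = 1" by (rule realization_set_sum(2)[OF assms(1) f, of "{u, v}", simplified])
    then show ?thesis using assms(3) by simp
  qed
  show "f i = 0" if "f u + f v = 1" "i \<noteq> u" "i \<noteq> v" for i
    using realization_set_sum(1)[OF assms(1) f, of "{i, u, v}"] that assms f
    by (simp add: realization_set_def) (metis add.commute add_le_same_cancel1 antisym)
qed

text \<open>A simplex of the enlarged complex other than the new edge does not contain both \<open>u\<close> and \<open>v\<close>.\<close>
lemma Old_realization:
  assumes "graph K" "{u} \<in> K" "{v} \<in> K" "u \<noteq> v" "{u, v} \<notin> K"
  shows "edge_attachment.Old (realization_set (add_edge u v K)) u v = realization_set K"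
proof -
  interpret edge_attachment "realization_set (add_edge u v K)" u v
    using edge_attachment_realization[OF graph_add_edge[OF assms(1-4)]] assms(4) by (simp add: add_edge_def)
  show ?thesis
  proof (intro Set.set_eqI)
    fix f
    have "f u = 0 \<or> f v = 0" if "support f \<in> K"
    proof (rule ccontr)
      assume "\<not> ?thesis"
      then have "{u, v} \<subseteq> support f" by (auto simp: support_def)
      then show False using graph_simplex(4)[OF assms(1) that, of "{u, v}"] assms by auto
    qed
    moreover have "support f \<noteq> {u, v}" if "f u = 0 \<or> f v = 0"
      using that by (auto simp: support_def)
    ultimately show "f \<in> Old \<longleftrightarrow> f \<in> realization_set K"
      unfolding Old_def by (auto simp: realization_set_def add_edge_def)
  qed
qed

lemma vertex_point_edge:
  assumes "edge_attachment X u v"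
  shows "edge_attachment.end_u u v = vertex_point u" "edge_attachment.end_v u v = vertex_point v"
proof -
  interpret edge_attachment X u v by fact
  show "end_u = vertex_point u" "end_v = vertex_point v"
    using uv by (auto simp: end_u_def end_v_def edge_point_def vertex_point_def fun_eq_iff indicator_def)
qed

lemma openin_star:
  assumes "finite s"
  shows "openin (top_of_set R) {g \<in> R. \<forall>i\<in>s. g i > (0::real)}"
  using assms
proof (induction s)
  case empty
  then show ?case by simp
next
  case (insert x s)
  have "{g \<in> R. \<forall>i\<in>insert x s. g i > 0} = {g \<in> R. g x > 0} \<inter> {g \<in> R. \<forall>i\<in>s. g i > 0}" by auto
  then show ?case
    using openin_Int[OF openin_superlevel[OF continuous_on_coordinate, of R 0 x] insert.IH] by (simp only:)
qed

text \<open>If \<open>g\<close> is positive wherever \<open>f\<close> is, both lie in the closed simplex spanned by the support of \<open>g\<close>.\<close>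
lemma segment_in_realization:
  assumes "graph K" "f \<in> realization_set K" "g \<in> realization_set K" "\<forall>i\<in>support f. g i > 0" "0 \<le> s" "s \<le> 1"
  shows "segment_point s f g \<in> realization_set K"
proof (rule realization_setI[OF assms(1), where s = "support g"])
  show "support g \<in> K" using assms by (simp add: realization_set_def)
  have f0: "f i = 0" if "g i = 0" for i using assms(4) that by (force simp: support_def)
  then show "support (segment_point s f g) \<subseteq> support g"
    by (auto simp: support_def segment_point_def)
  show "0 \<le> segment_point s f g x" for x
    using assms by (simp add: segment_point_def realization_set_def)
  have fin: "finite (support g)" using graph_simplex(1)[OF assms(1) \<open>support g \<in> K\<close>] .
  have "support f \<subseteq> support g" using f0 by (auto simp: support_def)
  then have "sum f (support g) = 1" "sum g (support g) = 1"
    using realization_set_sum(2)[OF assms(1) _ fin] assms(2,3) by auto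
  then show "sum (segment_point s f g) (support g) = 1"
    by (simp add: segment_point_def sum.distrib flip: sum_distrib_left)
qed

text \<open>Realizations are locally path-connected: the open star of \<open>f\<close> is star-shaped about \<open>f\<close>, and by
  compactness of \<open>{0..1}\<close> the segments from \<open>f\<close> to points close to it stay in the given open set.\<close>
lemma open_connected_path_connected:
  assumes K: "graph K" and O: "openin (top_of_set (realization_set K)) W" "connected W"
  shows "path_connected W"
proof -
  let ?R = "realization_set K"
  have WR: "W \<subseteq> ?R" using O by (simp add: openin_imp_subset)
  have nbhd: "\<exists>T. openin (top_of_set W) T \<and> f \<in> T \<and> (\<forall>g\<in>T. path_component W f g)" if f: "f \<in> W" for f
  proof -
    let ?St = "{g \<in> ?R. \<forall>i\<in>support f. g i > 0}"
    have fR: "f \<in> ?R" using WR f by auto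
    have fin: "finite (support f)" using fR graph_simplex(1)[OF K] by (auto simp: realization_set_def)
    have fSt: "f \<in> ?St" using fR by (auto simp: realization_set_def support_def less_le)
    have cont: "continuous_on (?St \<times> {0..1::real}) (\<lambda>z. segment_point (snd z) f (fst z))"
      by (intro continuous_intros)
    have im: "(\<lambda>z. segment_point (snd z) f (fst z)) \<in> ?St \<times> {0..1} \<rightarrow> ?R"
      using segment_in_realization[OF K fR] by auto
    have "openin (top_of_set (?St \<times> {0..1})) (?St \<times> {0..1} \<inter> (\<lambda>z. segment_point (snd z) f (fst z)) -` W)"
      using continuous_openin_preimage[OF cont im O(1)] .
    then obtain Q where Q: "open Q" "?St \<times> {0..1} \<inter> (\<lambda>z. segment_point (snd z) f (fst z)) -` W = ?St \<times> {0..1} \<inter> Q"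
      by (auto simp: openin_open)
    have "z \<in> Q" if "z \<in> {f} \<times> {0..1}" for z
    proof -
      have "z \<in> ?St \<times> {0..1} \<inter> (\<lambda>z. segment_point (snd z) f (fst z)) -` W"
        using that fSt f by auto
      then show ?thesis using Q(2) by blast
    qed
    then have "{f} \<times> {0..1} \<subseteq> Q" by blast
    then obtain Y where Y: "f \<in> Y" "open Y" "Y \<times> {0..1} \<subseteq> Q"
      using Elementary_Topology.tube_lemma[OF compact_Icc Q(1)] by metis
    have "openin (top_of_set W) (W \<inter> ?St \<inter> Y)"
    proof -
      have "openin (top_of_set ?R) (?St \<inter> Y)"
        using openin_star[OF fin, of ?R] Y(2) by (metis (no_types, lifting) openin_Int_open)
      then have "openin (top_of_set W) (W \<inter> (?St \<inter> Y))"
        using WR by (meson openin_subtopology_Int2 openin_subtopology_Int_subset inf.orderE openin_subset_trans openin_Int openin_subtopology_self O)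
      then show ?thesis by (simp add: Int_assoc)
    qed
    moreover have "path_component W f g" if g: "g \<in> W \<inter> ?St \<inter> Y" for g
      unfolding path_component_def
    proof (intro exI[of _ "\<lambda>s. segment_point s f g"] conjI)
      show "path (\<lambda>s. segment_point s f g)"
        unfolding path_def by (intro continuous_intros)
      show "path_image (\<lambda>s. segment_point s f g) \<subseteq> W"
      proof
        fix h assume "h \<in> path_image (\<lambda>s. segment_point s f g)"
        then obtain s where s: "s \<in> {0..1}" "h = segment_point s f g" by (auto simp: path_image_def)
        then have "(g, s) \<in> ?St \<times> {0..1} \<inter> Q" using g Y(3) by blast
        then have "(g, s) \<in> (\<lambda>z. segment_point (snd z) f (fst z)) -` W" using Q(2) by blast
        then show "h \<in> W" using s by simp
      qed
    qed (auto simp: pathstart_def pathfinish_def)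
    ultimately show ?thesis using f fSt Y(1) by blast
  qed
  have "path_component W a b" if "a \<in> W" "b \<in> W" for a b
    by (rule connected_equivalence_relation[OF O(2) that])
       (use nbhd in \<open>auto intro: path_component_sym path_component_trans\<close>)
  then show ?thesis by (simp add: path_connected_component)
qed

text \<open>The total weight on the vertices reachable from \<open>u\<close> is continuous with values 0 and 1, hence constant
  on a connected realization.\<close>
lemma vertex_path_exists:
  assumes K: "graph K" and con: "connected (realization_set K)" and uv: "{u} \<in> K" "{v} \<in> K"
  shows "(\<lambda>x y. {x, y} \<in> K \<and> x \<noteq> y)\<^sup>*\<^sup>* u v"
proof (rule ccontr)
  let ?r = "\<lambda>x y. {x, y} \<in> K \<and> x \<noteq> y"
  assume nr: "\<not> ?r\<^sup>*\<^sup>* u v"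
  define T where "T = {x \<in> \<Union>K. ?r\<^sup>*\<^sup>* u x}"
  have "finite (\<Union>K)" using K graph_simplex(1)[OF K] by (auto simp: graph_def)
  then have fin: "finite T" by (rule rev_finite_subset) (auto simp: T_def)
  have vp: "vertex_point x \<in> realization_set K" if "{x} \<in> K" for x
    using that by (intro realization_setI[OF K, of _ "{x}"]) (auto simp: support_def vertex_point_def indicator_def split: if_splits)
  have c: "continuous_on (realization_set K) (\<lambda>f. sum f T)"
    by (intro continuous_intros)
  have val: "sum f T = 0 \<or> sum f T = 1" if f: "f \<in> realization_set K" for f
  proof (cases "support f \<inter> T = {}")
    case True
    then have "sum f T = 0" by (intro sum.neutral) (auto simp: support_def)
    then show ?thesis by simp
  next
    case False
    then obtain x where x: "x \<in> support f" "x \<in> T" by blast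
    have sK: "support f \<in> K" using f by (simp add: realization_set_def)
    have "support f \<subseteq> T"
    proof
      fix y assume y: "y \<in> support f"
      have "{x, y} \<in> K" using graph_simplex(4)[OF K sK, of "{x, y}"] x y by auto
      then show "y \<in> T"
        using x y sK by (cases "x = y") (auto simp: T_def intro: rtranclp.rtrancl_into_rtrancl)
    qed
    then show ?thesis using realization_set_sum(2)[OF K f fin] by simp
  qed
  have uT: "u \<in> T" "v \<notin> T" using uv nr by (auto simp: T_def)
  have "sum (vertex_point u) T = 1" "sum (vertex_point v) T = 0"
    using uT fin by (auto simp: vertex_point_def indicator_def)
  then have "1 \<in> (\<lambda>f. sum f T) ` realization_set K" "0 \<in> (\<lambda>f. sum f T) ` realization_set K"
    using vp uv by (metis image_eqI)+
  moreover have "connected ((\<lambda>f. sum f T) ` realization_set K)"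
    by (rule connected_continuous_image[OF c con])
  ultimately have "1/2 \<in> (\<lambda>f. sum f T) ` realization_set K"
    using connectedD_interval[of _ "0::real" 1 "1/2"] by simp
  then show False using val by force
qed

lemma interval_homeomorphic_unit:
  assumes "a < b"
  shows "top_of_set {a..b::real} homeomorphic_space top_of_set {0..1::real}"
proof -
  obtain f g where "homeomorphism {a..b} {0..1::real} f g"
    using homeomorphic_closed_intervals_real[OF assms, of 0 1] by (auto simp: homeomorphic_def)
  then show ?thesis
    unfolding homeomorphic_space_def homeomorphic_maps_def
    unfolding homeomorphism_def
    by (intro exI[of _ f] exI[of _ g]) (simp add: continuous_map_in_subtopology image_subset_iff_funcset[symmetric])
qed

text \<open>A simple edge path \<open>p 0, \<dots>, p n\<close> from \<open>u\<close> to \<open>v\<close> is parametrized by \<open>{0..n}\<close> with tent functions as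
  coordinates.  The parameter is recovered as the weighted sum of vertex numbers, so the image is an
  interval and cannot be the whole realization.\<close>
lemma arc_missing_point:
  assumes K: "graph K" and con: "connected (realization_set K)" and uv: "{u} \<in> K" "{v} \<in> K" "u \<noteq> v"
    and nint: "\<not> top_of_set (realization_set K) homeomorphic_space top_of_set {0..1::real}"
  obtains P w where "path_connected P" "vertex_point u \<in> P" "vertex_point v \<in> P" "P \<subseteq> realization_set K"
    "w \<in> realization_set K" "w \<notin> P"
proof -
  let ?r = "\<lambda>x y. {x, y} \<in> K \<and> x \<noteq> y"
  obtain xs0 where "rtrancl_path ?r u xs0 v"
    using vertex_path_exists[OF K con uv(1,2)] unfolding rtranclp_eq_rtrancl_path by blast
  then obtain xs where xs: "rtrancl_path ?r u xs v" "distinct (u # xs)"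
    by (rule rtrancl_path_distinct) blast
  have "xs \<noteq> []" using xs uv by (auto elim: rtrancl_path.cases)
  define n where "n = length xs"
  have n: "n \<ge> 1" using \<open>xs \<noteq> []\<close> by (cases xs) (auto simp: n_def)
  define p where "p k = (u # xs) ! k" for k
  have p0: "p 0 = u" and pn: "p n = v"
    using rtrancl_path_last[OF xs(1) \<open>xs \<noteq> []\<close>] \<open>xs \<noteq> []\<close>
    by (auto simp: p_def n_def last_conv_nth nth_Cons')
  have adj: "{p k, p (Suc k)} \<in> K" if "k < n" for k
    using rtrancl_path_nth[OF xs(1), of k] that by (simp add: p_def n_def)
  have inj: "p i = p j \<longleftrightarrow> i = j" if "i \<le> n" "j \<le> n" for i j
    using nth_eq_iff_index_eq[OF xs(2), of i j] that by (simp add: p_def n_def less_Suc_eq_le)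
  define \<gamma> :: "real \<Rightarrow> 'a \<Rightarrow> real" where
    "\<gamma> t = (\<lambda>i. \<Sum>k\<le>n. if p k = i then max 0 (1 - \<bar>t - real k\<bar>) else 0)" for t
  have \<gamma>p: "\<gamma> t (p j) = max 0 (1 - \<bar>t - real j\<bar>)" if "j \<le> n" for t j
  proof -
    have "\<gamma> t (p j) = (\<Sum>k\<le>n. if k = j then max 0 (1 - \<bar>t - real j\<bar>) else 0)"
      unfolding \<gamma>_def by (rule sum.cong) (use inj that in auto)
    then show ?thesis using that by simp
  qed
  have \<gamma>0: "\<gamma> t i = 0" if "i \<notin> p ` {..n}" for t i
    unfolding \<gamma>_def using that by (intro sum.neutral) auto
  have \<gamma>c: "continuous_on S \<gamma>" for S
  proof (rule continuous_on_coordinatewise_then_product)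
    fix i
    have "continuous_on S (\<lambda>t. if p k = i then max 0 (1 - \<bar>t - real k\<bar>) else 0)" for k
      by (cases "p k = i") (auto intro!: continuous_intros)
    then show "continuous_on S (\<lambda>t. \<gamma> t i)"
      unfolding \<gamma>_def by (intro continuous_on_sum) auto
  qed
  have loc: "\<exists>k<n. real k \<le> t \<and> t \<le> real k + 1" if t: "0 \<le> t" "t \<le> real n" for t
  proof (cases "t = real n")
    case True
    then show ?thesis using n by (intro exI[of _ "n - 1"]) (auto simp: of_nat_diff)
  next
    case False
    then have "nat \<lfloor>t\<rfloor> < n" using t by (simp add: nat_less_iff floor_less_iff)
    moreover have "real (nat \<lfloor>t\<rfloor>) \<le> t" "t \<le> real (nat \<lfloor>t\<rfloor>) + 1"
      using t by (simp_all add: of_nat_nat)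
    ultimately show ?thesis by blast
  qed
  have \<gamma>s: "\<gamma> t \<in> realization_set K \<and> (\<Sum>k\<le>n. real k * \<gamma> t (p k)) = t" if t: "0 \<le> t" "t \<le> real n" for t
  proof -
    obtain k where k: "k < n" "real k \<le> t" "t \<le> real k + 1" using loc[OF t] by blast
    have gk: "\<gamma> t (p k) = 1 - (t - k)" "\<gamma> t (p (Suc k)) = t - k"
      using k \<gamma>p[of k t] \<gamma>p[of "Suc k" t] by (auto simp: max_def)
    have other: "\<gamma> t (p j) = 0" if "j \<le> n" "j \<noteq> k" "j \<noteq> Suc k" for j
    proof -
      have "real j \<le> real k - 1 \<or> real j \<ge> real k + 2" using that by linarith
      then show ?thesis using \<gamma>p[OF that(1), of t] k by (auto simp: max_def)
    qed
    have supp: "support (\<gamma> t) \<subseteq> {p k, p (Suc k)}"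
    proof
      fix i assume "i \<in> support (\<gamma> t)"
      then have nz: "\<gamma> t i \<noteq> 0" by (simp add: support_def)
      then obtain j where "i = p j" "j \<le> n" using \<gamma>0[of i t] by auto
      then show "i \<in> {p k, p (Suc k)}" using other[of j] nz by auto
    qed
    have pk: "p k \<noteq> p (Suc k)" using inj[of k "Suc k"] k by simp
    have "\<gamma> t \<in> realization_set K"
    proof (rule realization_setI[OF K _ supp adj[OF k(1)]])
      show "0 \<le> \<gamma> t x" for x
        unfolding \<gamma>_def by (intro sum_nonneg) auto
      show "sum (\<gamma> t) {p k, p (Suc k)} = 1" using pk gk by simp
    qed
    moreover have "(\<Sum>j\<le>n. real j * \<gamma> t (p j)) = (\<Sum>j\<in>{k, Suc k}. real j * \<gamma> t (p j))"
      using k other by (intro sum.mono_neutral_right) auto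
    moreover have "\<dots> = t" by (simp add: gk algebra_simps)
    ultimately show ?thesis by simp
  qed
  let ?I = "{0..real n}"
  have sub: "\<gamma> ` ?I \<subseteq> realization_set K" using \<gamma>s by auto
  \<comment> \<open>Otherwise the tent parametrization and its inverse make the graph an interval.\<close>
  have "\<gamma> ` ?I \<noteq> realization_set K"
  proof
    assume eq: "\<gamma> ` ?I = realization_set K"
    have "top_of_set (realization_set K) homeomorphic_space top_of_set ?I"
      unfolding homeomorphic_space_def homeomorphic_maps_def
    proof (intro exI[of _ "\<lambda>f. \<Sum>k\<le>n. real k * f (p k)"] exI[of _ \<gamma>] conjI)
      have "continuous_on (realization_set K) (\<lambda>f. \<Sum>k\<le>n. real k * f (p k))"
        by (intro continuous_intros)
      then show "continuous_map (top_of_set (realization_set K)) (top_of_set ?I) (\<lambda>f. \<Sum>k\<le>n. real k * f (p k))"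
        using \<gamma>s by (auto simp: continuous_map_in_subtopology simp flip: eq)
      show "continuous_map (top_of_set ?I) (top_of_set (realization_set K)) \<gamma>"
        using \<gamma>c sub by (auto simp: continuous_map_in_subtopology)
    qed (use \<gamma>s in \<open>auto simp flip: eq\<close>)
    moreover have "top_of_set ?I homeomorphic_space top_of_set {0..1::real}"
      using n by (intro interval_homeomorphic_unit) auto
    ultimately show False using nint homeomorphic_space_trans by blast
  qed
  then obtain w where w: "w \<in> realization_set K" "w \<notin> \<gamma> ` ?I" using sub by blast
  have vert: "\<gamma> (real k) = vertex_point (p k)" if k: "k \<le> n" for k
  proof
    fix i
    show "\<gamma> (real k) i = vertex_point (p k) i"
    proof (cases "i \<in> p ` {..n}")
      case False
      then have "i \<noteq> p k" using k by auto
      then show ?thesis using \<gamma>0[OF False] by (simp add: vertex_point_def)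
    next
      case True
      then obtain j where j: "i = p j" "j \<le> n" by auto
      have "1 - \<bar>real k - real j\<bar> \<le> 0" if "j \<noteq> k" using that by linarith
      then show ?thesis
        using \<gamma>p[OF j(2), of "real k"] inj[OF j(2) k] j by (cases "j = k") (auto simp: vertex_point_def)
    qed
  qed
  show thesis
  proof (rule that[of "\<gamma> ` ?I" w])
    show "path_connected (\<gamma> ` ?I)"
      by (intro path_connected_continuous_image \<gamma>c convex_imp_path_connected) auto
    show "vertex_point u \<in> \<gamma> ` ?I" using vert[of 0] p0 by (intro image_eqI[of _ _ "0::real"]) auto
    show "vertex_point v \<in> \<gamma> ` ?I" using vert[of n] pn by (intro image_eqI[of _ _ "real n"]) auto
  qed (use w sub in auto)
qed

text \<open>The image in \<open>{0..1}\<close> is compact and connected with at least two points, thus an interval \<open>{c..d}\<close> with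
  \<open>c < d\<close>.\<close>
lemma closed_connected_subset_of_unit_interval:
  assumes h: "top_of_set S homeomorphic_space top_of_set {0..1::real}"
    and R: "closedin (top_of_set S) R" "connected R" "a \<in> R" "b \<in> R" "a \<noteq> b"
  shows "top_of_set R homeomorphic_space top_of_set {0..1::real}"
proof -
  obtain f where f: "homeomorphic_map (top_of_set S) (top_of_set {0..1::real}) f"
    using h homeomorphic_space by blast
  have RS: "R \<subseteq> S" using R(1) by (simp add: closedin_imp_subset)
  have "closedin (top_of_set {0..1}) (f ` R)"
    using homeomorphic_map_closedness_eq[OF f] R(1) by blast
  then have "compact (f ` R)" by (rule closedin_compact[OF compact_Icc])
  moreover have "connected (f ` R)"
  proof (rule connected_continuous_image[OF _ R(2)])
    have "continuous_on S f"
      using homeomorphic_imp_continuous_map[OF f] by (simp add: continuous_map_in_subtopology)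
    then show "continuous_on R f" using RS continuous_on_subset by blast
  qed
  ultimately obtain c d where cd: "f ` R = {c..d}"
    using connected_compact_interval_1[of "f ` R"] by blast
  have "inj_on f S" using homeomorphic_imp_injective_map[OF f] by simp
  then have "f a \<noteq> f b" using R(3-5) RS inj_on_eq_iff[of f S a b] by blast
  moreover have "f a \<in> {c..d}" "f b \<in> {c..d}" using R(3,4) by (simp_all flip: cd)
  ultimately have "c < d" by auto
  have "f ` S = {0..1}"
    using homeomorphic_imp_surjective_map[OF f] by simp
  then have "{c..d} \<subseteq> {0..1}" using RS cd by blast
  have "homeomorphic_map (subtopology (top_of_set S) R) (subtopology (top_of_set {0..1}) {c..d}) f"
  proof (rule homeomorphic_map_subtopologies[OF f])
    have "S \<inter> R = R" "{0..1} \<inter> {c..d} = {c..d}" using RS \<open>{c..d} \<subseteq> {0..1}\<close> by blast+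
    then show "f ` (topspace (top_of_set S) \<inter> R) = topspace (top_of_set {0..1}) \<inter> {c..d}"
      using cd by (simp only: topspace_euclidean_subtopology)
  qed
  then have "homeomorphic_map (top_of_set R) (top_of_set {c..d}) f"
    using RS \<open>{c..d} \<subseteq> {0..1}\<close> by (simp only: subtopology_subtopology Int_absorb1)
  then have "top_of_set R homeomorphic_space top_of_set {c..d}"
    by (rule homeomorphic_map_imp_homeomorphic_space)
  then show ?thesis
    using interval_homeomorphic_unit[OF \<open>c < d\<close>] homeomorphic_space_trans by blast
qed

section \<open>Adding an edge preserves maturity\<close>

lemma Hmap_swap_iso:
  fixes S :: "('a::topological_space \<times> 'b::topological_space) set"
  shows "Hmap p S (prod.swap ` S) prod.swap \<in> iso (H p S) (H p (prod.swap ` S))"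
proof (rule homeomorphic_map_homology_iso)
  show "homeomorphic_map (top_of_set S) (top_of_set (prod.swap ` S)) prod.swap"
  proof (rule homeomorphic_maps_imp_map)
    show "homeomorphic_maps (top_of_set S) (top_of_set (prod.swap ` S)) prod.swap prod.swap"
      unfolding homeomorphic_maps_def
      by (auto simp: continuous_map_in_subtopology prod.swap_def intro!: continuous_intros)
  qed
qed

lemma Hmap_inclusion_swap:
  fixes S T :: "('a::topological_space \<times> 'b::topological_space) set"
  assumes "S \<subseteq> T" "Hmap p S T id \<in> iso (H p S) (H p T)"
  shows "Hmap p (prod.swap ` S) (prod.swap ` T) id \<in> iso (H p (prod.swap ` S)) (H p (prod.swap ` T))"
proof -
  let ?s = "Hmap p (prod.swap ` S) S prod.swap" and ?t = "Hmap p T (prod.swap ` T) prod.swap"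
  have cs: "continuous_on A (prod.swap :: 'c::topological_space \<times> 'd::topological_space \<Rightarrow> _)" for A
    unfolding prod.swap_def by (intro continuous_intros)
  have e: "prod.swap ` prod.swap ` S = S" by (simp add: image_image)
  have "?s \<in> iso (H p (prod.swap ` S)) (H p S)"
    using Hmap_swap_iso[of p "prod.swap ` S"] unfolding e .
  then have "?t \<circ> (Hmap p S T id \<circ> ?s) \<in> iso (H p (prod.swap ` S)) (H p (prod.swap ` T))"
    using assms(2) Hmap_swap_iso by (intro iso_set_trans)
  \<comment> \<open>Exchanging the factors before and after an inclusion gives the inclusion of the exchanged sets.\<close>
  moreover have "?t \<circ> (Hmap p S T id \<circ> ?s) = Hmap p (prod.swap ` S) (prod.swap ` T) id"
  proof
    fix c
    have "Hmap p S T id (?s c) = Hmap p (prod.swap ` S) T (id \<circ> prod.swap) c"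
      using assms(1) by (intro Hmap_comp cs) auto
    also have "?t \<dots> = Hmap p (prod.swap ` S) (prod.swap ` T) (prod.swap \<circ> (id \<circ> prod.swap)) c"
      using assms(1) by (intro Hmap_comp) (auto simp: cs)
    also have "\<dots> = Hmap p (prod.swap ` S) (prod.swap ` T) id c"
      by (rule fun_cong[OF Hmap_cong]) simp
    finally show "(?t \<circ> (Hmap p S T id \<circ> ?s)) c = Hmap p (prod.swap ` S) (prod.swap ` T) id c" by simp
  qed
  ultimately show ?thesis by simp
qed

lemma connected_space_top_of_set: "connected_space (top_of_set R) \<longleftrightarrow> connected R"
  using connectedin_iff_connected[of R] by (simp add: connectedin_def)

lemma mature_iff:
  "mature K \<longleftrightarrow> graph K \<and> connected (realization_set K) \<and>
     \<not> top_of_set (realization_set K) homeomorphic_space top_of_set {0..1::real} \<and>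
     Hmap 1 {z \<in> realization_set K \<times> realization_set K. fst z \<noteq> snd z} (realization_set K \<times> realization_set K) id
       \<in> iso (H 1 {z \<in> realization_set K \<times> realization_set K. fst z \<noteq> snd z})
            (H 1 (realization_set K \<times> realization_set K))"
proof -
  have "config2 (realization K) = top_of_set {z \<in> realization_set K \<times> realization_set K. fst z \<noteq> snd z}"
    by (simp add: config2_def realization_eq subtopology_subtopology Int_def case_prod_unfold)
  moreover have "prod_topology (realization K) (realization K) = top_of_set (realization_set K \<times> realization_set K)"
    by (simp add: realization_eq)
  ultimately show ?thesis
    by (simp add: mature_def realization_eq connected_space_top_of_set)
qed

lemma neighbour_exists:
  assumes "graph K" "connected (realization_set K)" "{u} \<in> K" "{v} \<in> K" "u \<noteq> v"
  obtains x where "{v, x} \<in> K" "x \<noteq> v"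
proof -
  have "(\<lambda>x y. {x, y} \<in> K \<and> x \<noteq> y)\<^sup>*\<^sup>* u v"
    by (rule vertex_path_exists[OF assms(1-4)])
  then show thesis
    by (cases rule: rtranclp.cases) (use assms that in \<open>auto simp: insert_commute\<close>)
qed

text \<open>The vertex \<open>v\<close> has a neighbour other than \<open>u\<close>, so an edge avoiding \<open>u\<close> joins it to the rest.\<close>
lemma path_connected_add_vertex:
  assumes "graph K" "connected (realization_set K)" "{u} \<in> K" "{v} \<in> K" "u \<noteq> v" "{u, v} \<notin> K"
    and pc: "path_connected (realization_set K - {vertex_point u, vertex_point v})"
  shows "path_connected (realization_set K - {vertex_point u})"
proof -
  let ?R = "realization_set K"
  obtain x where x: "{v, x} \<in> K" "x \<noteq> v" by (rule neighbour_exists[OF assms(1-5)])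
  have xu: "x \<noteq> u" using x assms by (auto simp: insert_commute)
  let ?e = "\<lambda>a::real. \<lambda>i. if i = v then a else if i = x then 1 - a else 0"
  have e1: "?e 1 = vertex_point v" using x by (auto simp: vertex_point_def indicator_def)
  have eu: "?e a \<noteq> vertex_point u" for a
    using xu assms(5) by (auto simp: vertex_point_def fun_eq_iff intro!: exI[of _ u])
  have ev: "?e (1/2) \<noteq> vertex_point v"
    by (auto simp: vertex_point_def fun_eq_iff intro!: exI[of _ v])
  have eR: "?e a \<in> ?R" if "a \<in> {0..1}" for a
    using edge_point_realization[OF assms(1) x(1), of a] x(2) that by simp
  have pce: "path_connected (?e ` {0..1})"
  proof (intro path_connected_continuous_image continuous_on_coordinatewise_then_product)
    show "continuous_on {0..1} (\<lambda>a. ?e a i)" for i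
      by (cases "i = v"; cases "i = x") (auto intro!: continuous_intros)
  qed (auto intro: convex_imp_path_connected)
  have "?e (1/2) \<in> (?R - {vertex_point u, vertex_point v}) \<inter> ?e ` {0..1}"
    using eR[of "1/2"] eu[of "1/2"] ev by auto
  then have "path_connected ((?R - {vertex_point u, vertex_point v}) \<union> ?e ` {0..1})"
    by (intro path_connected_Un pc pce) auto
  moreover have "?R - {vertex_point u} = (?R - {vertex_point u, vertex_point v}) \<union> ?e ` {0..1}"
  proof -
    have "vertex_point v \<in> ?e ` {0..1}" by (rule image_eqI[of _ _ 1]) (simp_all add: e1)
    moreover have "?e ` {0..1} \<subseteq> ?R - {vertex_point u}" using eR eu by auto
    ultimately show ?thesis by blast
  qed
  ultimately show ?thesis by simp
qed

theorem theorem1: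
  fixes K :: "'v set set" and u v :: 'v
  assumes "mature K"
    and "{u} \<in> K" and "{v} \<in> K" and "u \<noteq> v"
    and "connected_space (subtopology (realization K)
           (topspace (realization K) - {vertex_point u, vertex_point v}))"
  shows "mature (add_edge u v K)"
proof (cases "{u, v} \<in> K")
  case True
  then show ?thesis using assms(1) by (simp add: add_edge_def insert_absorb)
next
  case False
  let ?R = "realization_set K" and ?X = "realization_set (add_edge u v K)"
  have K: "graph K" "connected ?R" "\<not> top_of_set ?R homeomorphic_space top_of_set {0..1::real}"
    and iso: "Hmap 1 {z \<in> ?R \<times> ?R. fst z \<noteq> snd z} (?R \<times> ?R) id
      \<in> iso (H 1 {z \<in> ?R \<times> ?R. fst z \<noteq> snd z}) (H 1 (?R \<times> ?R))"
    using assms(1) unfolding mature_iff by auto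
  have K': "graph (add_edge u v K)" using graph_add_edge[OF K(1) assms(2-4)] .
  interpret edge_attachment ?X u v
    using edge_attachment_realization[OF K' _ assms(4)] by (simp add: add_edge_def)
  have Old: "Old = ?R" by (rule Old_realization[OF K(1) assms(2-4) False])
  have UV: "end_u = vertex_point u" "end_v = vertex_point v"
    by (rule vertex_point_edge[OF edge_attachment_axioms])+
  have con: "connected (?R - {end_u, end_v})"
    using assms(5) by (simp add: realization_eq UV subtopology_subtopology Int_absorb1 connected_space_top_of_set)
  have op: "openin (top_of_set ?R) (?R - {end_u, end_v})"
  proof -
    have "?R - {end_u, end_v} = (Old - {end_u}) \<inter> (Old - {end_v})" by (auto simp: Old)
    then show ?thesis using openin_Int[OF openin_Old_minus_end] by (simp add: Old)
  qed
  have pcUV: "path_connected (?R - {end_u, end_v})"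
    by (rule open_connected_path_connected[OF K(1) op con])
  have pcU: "path_connected (?R - {end_u})"
    using path_connected_add_vertex[OF K(1,2) assms(2-4) False] pcUV by (simp add: UV)
  have pcV: "path_connected (?R - {end_v})"
    using path_connected_add_vertex[OF K(1,2) assms(3,2) assms(4)[symmetric]] False pcUV
    by (simp add: UV insert_commute)
  obtain P w where Pw: "path_connected P" "vertex_point u \<in> P" "vertex_point v \<in> P" "P \<subseteq> ?R"
    "w \<in> ?R" "w \<notin> P"
    by (rule arc_missing_point[OF K(1,2) assms(2-4) K(3)])
  interpret connected_edge_attachment ?X u v P w
    by unfold_locales (use pcUV pcU pcV Pw in \<open>simp_all add: Old UV\<close>)
  have "Hmap 1 (Conf_old Old) (Old \<times> Old) id \<in> iso (H 1 (Conf_old Old)) (H 1 (Old \<times> Old))"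
    using iso by (simp add: Conf_old_def Old)
  then have "Hmap 1 (Conf Old) (Old \<times> ?X) id \<in> iso (H 1 (Conf Old)) (H 1 (Old \<times> ?X))"
    by (intro second_factor_step) auto
  moreover have "Conf Old \<subseteq> Old \<times> ?X" by (auto simp: Conf_def)
  moreover have "prod.swap ` Conf Old = Conf_old ?X" "prod.swap ` (Old \<times> ?X) = ?X \<times> Old"
    by (auto simp: Conf_def Conf_old_def image_iff)
  ultimately have "Hmap 1 (Conf_old ?X) (?X \<times> Old) id \<in> iso (H 1 (Conf_old ?X)) (H 1 (?X \<times> Old))"
    using Hmap_inclusion_swap by metis
  then have "Hmap 1 (Conf ?X) (?X \<times> ?X) id \<in> iso (H 1 (Conf ?X)) (H 1 (?X \<times> ?X))"
    by (intro second_factor_step) auto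
  moreover have "\<not> top_of_set ?X homeomorphic_space top_of_set {0..1::real}"
  proof
    assume h: "top_of_set ?X homeomorphic_space top_of_set {0..1::real}"
    have "Old = ?X - Open_edge" using part_inclusions Old_iff_not_Open_edge by blast
    then have "closedin (top_of_set ?X) ?R"
      using openin_Open_edge by (simp add: Old[symmetric] closedin_diff)
    then show False
      using closed_connected_subset_of_unit_interval[OF h _ K(2), of end_u end_v] ends_in K(3) Old by metis
  qed
  moreover have "connected ?X" using path_connected_X by (rule path_connected_imp_connected)
  ultimately show ?thesis
    using K' unfolding mature_iff Conf_def by blast
qed

end
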